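(* Let $k \geq 5$ and $n \geq 2(k-1)(k-3)$ be integers. Then $\mathrm{Sp}(2n,\mathbb{Z})$ is generated by four elements of order $k$. When $k \geq 6$ and $n \geq 2((k-1)^2+1)$, three elements of order $k$ suffice to generate $\mathrm{Sp}(2n,\mathbb{Z})$.
   Context: $\mathrm{Sp}(2n,\mathbb{Z})$ is the integral symplectic group: the group of $2n\times 2n$ integer matrices that preserve the standard symplectic form on $\mathbb{R}^{2n}$. *)

theory Defs
  imports "Jordan_Normal_Form.Determinant" "HOL-Algebra.Multiplicative_Group" "HOL-Algebra.Generated_Groups"
begin

(* The standard symplectic form on R^{2n}: with e_0, ..., e_{2n-1} the standard basis,
   e_i is paired with e_{n+i} for i < n. *)
definition symp_form :: "nat \<Rightarrow> real vec \<Rightarrow> real vec \<Rightarrow> real" where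
  "symp_form n x y = (\<Sum>i<n. x $ i * y $ (n + i) - x $ (n + i) * y $ i)"

definition Sp_int :: "nat \<Rightarrow> int mat monoid" where
  "Sp_int n = \<lparr> carrier = {A \<in> carrier_mat (2 * n) (2 * n).
       \<forall>x \<in> carrier_vec (2 * n). \<forall>y \<in> carrier_vec (2 * n).
         symp_form n (map_mat real_of_int A *\<^sub>v x) (map_mat real_of_int A *\<^sub>v y) = symp_form n x y},
     mult = (*), one = 1\<^sub>m (2 * n) \<rparr>"

(* The constants group.ord and generate have their intended meaning only in a group;
   the remainder of this theory proves that Sp_int n is one. *)

definition symp_mat :: "nat \<Rightarrow> int mat" where
  "symp_mat n = mat (2 * n) (2 * n)
     (\<lambda>(i, j). if j = n + i then 1 else if i = n + j then -1 else 0)"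

lemma symp_mat_carrier [simp]: "symp_mat n \<in> carrier_mat (2 * n) (2 * n)"
  by (simp add: symp_mat_def)

lemma symp_mat_mult_vec:
  assumes y: "y \<in> carrier_vec (2 * n)" and i: "i < n"
  shows "(map_mat real_of_int (symp_mat n) *\<^sub>v y) $ i = y $ (n + i)"
    and "(map_mat real_of_int (symp_mat n) *\<^sub>v y) $ (n + i) = - y $ i"
proof -
  have "(map_mat real_of_int (symp_mat n) *\<^sub>v y) $ i
      = (\<Sum>j<2*n. (if j = n + i then y $ j else 0))"
    using y i unfolding lessThan_atLeast0
    by (auto simp: symp_mat_def scalar_prod_def simp del: sum.delta sum.delta' intro!: sum.cong)
  also have "\<dots> = y $ (n + i)" using i by (simp add: sum.delta)
  finally show "(map_mat real_of_int (symp_mat n) *\<^sub>v y) $ i = y $ (n + i)" .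
  have "(map_mat real_of_int (symp_mat n) *\<^sub>v y) $ (n + i)
      = (\<Sum>j<2*n. (if j = i then - y $ j else 0))"
    using y i unfolding lessThan_atLeast0
    by (auto simp: symp_mat_def scalar_prod_def simp del: sum.delta sum.delta' intro!: sum.cong)
  also have "\<dots> = - y $ i" using i by (simp add: sum.delta)
  finally show "(map_mat real_of_int (symp_mat n) *\<^sub>v y) $ (n + i) = - y $ i" .
qed

lemma symp_form_eq:
  assumes x: "x \<in> carrier_vec (2 * n)" and y: "y \<in> carrier_vec (2 * n)"
  shows "symp_form n x y = x \<bullet> (map_mat real_of_int (symp_mat n) *\<^sub>v y)"
proof -
  let ?z = "map_mat real_of_int (symp_mat n) *\<^sub>v y"
  have z: "dim_vec ?z = 2 * n" by (simp add: symp_mat_def)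
  have "x \<bullet> ?z = (\<Sum>j = 0..<n + n. x $ j * ?z $ j)"
    unfolding scalar_prod_def z by (simp add: mult_2)
  also have "\<dots> = (\<Sum>j<n. x $ j * ?z $ j) + (\<Sum>j<n. x $ (n + j) * ?z $ (n + j))"
    using sum.nat_group[of "\<lambda>j. x $ j * ?z $ j"] sum.atLeastLessThan_concat[of 0 n "n + n" "\<lambda>j. x $ j * ?z $ j"]
      sum.shift_bounds_nat_ivl[of "\<lambda>j. x $ j * ?z $ j" 0 n n]
    by (simp add: atLeast0LessThan add.commute)
  also have "\<dots> = (\<Sum>j<n. x $ j * y $ (n + j)) + (\<Sum>j<n. x $ (n + j) * - y $ j)"
    using symp_mat_mult_vec[OF y] by simp
  also have "\<dots> = symp_form n x y"
    by (simp add: symp_form_def sum_subtractf sum_negf)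
  finally show ?thesis by simp
qed

lemma symp_mat_square: "symp_mat n * symp_mat n = - 1\<^sub>m (2 * n)"
proof (rule eq_matI)
  fix i j assume ij: "i < dim_row (- 1\<^sub>m (2 * n) :: int mat)" "j < dim_col (- 1\<^sub>m (2 * n) :: int mat)"
  then have ij: "i < 2 * n" "j < 2 * n" by auto
  have "(symp_mat n * symp_mat n) $$ (i, j)
      = (\<Sum>k = 0..<2 * n. symp_mat n $$ (i, k) * symp_mat n $$ (k, j))"
    using ij by (simp add: symp_mat_def scalar_prod_def)
  also have "\<dots> = (\<Sum>k = 0..<2 * n.
      if k = (if i < n then n + i else i - n) then (if i = j then - 1 else 0) else 0)"
    using ij by (intro sum.cong refl) (auto simp: symp_mat_def)
  also have "\<dots> = (- 1\<^sub>m (2 * n)) $$ (i, j)"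
    using ij by (subst sum.delta) auto
  finally show "(symp_mat n * symp_mat n) $$ (i, j) = (- 1\<^sub>m (2 * n)) $$ (i, j)" .
qed (auto simp: symp_mat_def)

lemma Sp_int_mem_iff:
  "A \<in> carrier (Sp_int n) \<longleftrightarrow>
     A \<in> carrier_mat (2 * n) (2 * n) \<and> transpose_mat A * symp_mat n * A = symp_mat n"
proof (cases "A \<in> carrier_mat (2 * n) (2 * n)")
  case A: True
  let ?r = "map_mat real_of_int" and ?N = "2 * n"
  let ?M = "transpose_mat A * symp_mat n * A"
  have rA: "?r A \<in> carrier_mat ?N ?N" and rJ: "?r (symp_mat n) \<in> carrier_mat ?N ?N"
    and M: "?M \<in> carrier_mat ?N ?N" and rM: "?r ?M \<in> carrier_mat ?N ?N"
    using A by auto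
  have rM_eq: "?r ?M = transpose_mat (?r A) * ?r (symp_mat n) * ?r A"
    using A by (simp add: of_int_hom.mat_hom_mult[of _ ?N ?N _ ?N] map_mat_transpose)
  have form: "symp_form n (?r A *\<^sub>v x) (?r A *\<^sub>v y) = x \<bullet> (?r ?M *\<^sub>v y)"
    if x: "x \<in> carrier_vec ?N" and y: "y \<in> carrier_vec ?N" for x y
  proof -
    let ?w = "?r (symp_mat n) *\<^sub>v (?r A *\<^sub>v y)"
    have w: "?w \<in> carrier_vec ?N"
      using rJ rA y by (intro mult_mat_vec_carrier[of _ ?N ?N]) auto
    have "symp_form n (?r A *\<^sub>v x) (?r A *\<^sub>v y) = (?r A *\<^sub>v x) \<bullet> ?w"
      using rA x y by (intro symp_form_eq) auto
    also have "\<dots> = ?w \<bullet> (?r A *\<^sub>v x)"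
      using rA w x by (intro comm_scalar_prod[of _ ?N]) auto
    also have "\<dots> = (transpose_mat (?r A) *\<^sub>v ?w) \<bullet> x"
      using transpose_vec_mult_scalar[OF rA x w] by simp
    also have "transpose_mat (?r A) *\<^sub>v ?w = ?r ?M *\<^sub>v y"
      unfolding rM_eq using rA rJ y
      by (simp add: assoc_mult_mat_vec[of _ ?N ?N _ ?N])
    also have "(?r ?M *\<^sub>v y) \<bullet> x = x \<bullet> (?r ?M *\<^sub>v y)"
      using rM x y by (intro comm_scalar_prod[of _ ?N] mult_mat_vec_carrier[of _ ?N ?N])
    finally show ?thesis .
  qed
  have unit: "unit_vec ?N i \<bullet> (?r B *\<^sub>v unit_vec ?N j) = real_of_int (B $$ (i, j))"
    if "B \<in> carrier_mat ?N ?N" "i < ?N" "j < ?N" for B i j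
    using that by (simp add: scalar_prod_left_unit[of _ ?N])
  show ?thesis
  proof (intro iffI conjI)
    assume mem: "A \<in> carrier (Sp_int n)"
    show "?M = symp_mat n"
    proof (rule eq_matI)
      fix i j assume "i < dim_row (symp_mat n)" "j < dim_col (symp_mat n)"
      then have ij: "i < ?N" "j < ?N" by (auto simp: symp_mat_def)
      have "unit_vec ?N i \<bullet> (?r ?M *\<^sub>v unit_vec ?N j)
          = unit_vec ?N i \<bullet> (?r (symp_mat n) *\<^sub>v unit_vec ?N j)"
        using mem form[of "unit_vec ?N i" "unit_vec ?N j"]
          symp_form_eq[of "unit_vec ?N i" n "unit_vec ?N j"]
        by (simp add: Sp_int_def)
      then show "?M $$ (i, j) = symp_mat n $$ (i, j)"
        using unit[OF M ij] unit[OF symp_mat_carrier ij] by linarith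
    qed (use M in \<open>auto simp: symp_mat_def\<close>)
  next
    assume "A \<in> carrier_mat ?N ?N \<and> ?M = symp_mat n"
    then show "A \<in> carrier (Sp_int n)"
      using form symp_form_eq by (simp add: Sp_int_def)
  qed (rule A)
qed (simp add: Sp_int_def)

lemma group_Sp_int: "group (Sp_int n)"
proof (rule groupI)
  let ?N = "2 * n" and ?J = "symp_mat n" and ?r = "map_mat real_of_int"
  have J: "?J \<in> carrier_mat ?N ?N" by simp
  have mult: "mult (Sp_int n) = (*)" and one: "one (Sp_int n) = 1\<^sub>m ?N"
    by (simp_all add: Sp_int_def)
  have carr: "A \<in> carrier_mat ?N ?N" if "A \<in> carrier (Sp_int n)" for A
    using that by (simp add: Sp_int_def)
  show "x \<otimes>\<^bsub>Sp_int n\<^esub> y \<in> carrier (Sp_int n)"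
    if x: "x \<in> carrier (Sp_int n)" and y: "y \<in> carrier (Sp_int n)" for x y
  proof -
    note X = carr[OF x] and Y = carr[OF y]
    have "symp_form n (?r (x * y) *\<^sub>v u) (?r (x * y) *\<^sub>v v) = symp_form n u v"
      if u: "u \<in> carrier_vec ?N" and v: "v \<in> carrier_vec ?N" for u v
    proof -
      have e: "?r (x * y) *\<^sub>v w = ?r x *\<^sub>v (?r y *\<^sub>v w)" if "w \<in> carrier_vec ?N" for w
        using X Y that by (simp add: of_int_hom.mat_hom_mult[OF X Y] assoc_mult_mat_vec[of _ ?N ?N _ ?N])
      have "?r y *\<^sub>v w \<in> carrier_vec ?N" if "w \<in> carrier_vec ?N" for w
        using Y that by (intro mult_mat_vec_carrier[of _ ?N ?N]) auto
      then show ?thesis using x y u v by (simp add: e Sp_int_def)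
    qed
    then show ?thesis using X Y by (simp add: Sp_int_def)
  qed
  show "\<one>\<^bsub>Sp_int n\<^esub> \<in> carrier (Sp_int n)"
    using left_mult_one_mat[OF J] right_mult_one_mat[OF J] by (simp add: Sp_int_mem_iff one)
  show "x \<otimes>\<^bsub>Sp_int n\<^esub> y \<otimes>\<^bsub>Sp_int n\<^esub> z = x \<otimes>\<^bsub>Sp_int n\<^esub> (y \<otimes>\<^bsub>Sp_int n\<^esub> z)"
    if "x \<in> carrier (Sp_int n)" "y \<in> carrier (Sp_int n)" "z \<in> carrier (Sp_int n)" for x y z
    using assoc_mult_mat[OF carr carr carr, OF that] by (simp add: mult)
  show "\<one>\<^bsub>Sp_int n\<^esub> \<otimes>\<^bsub>Sp_int n\<^esub> x = x" if "x \<in> carrier (Sp_int n)" for x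
    using carr[OF that] by (simp add: mult one)
  show "\<exists>y\<in>carrier (Sp_int n). y \<otimes>\<^bsub>Sp_int n\<^esub> x = \<one>\<^bsub>Sp_int n\<^esub>"
    if x: "x \<in> carrier (Sp_int n)" for x
  proof -
    note X = carr[OF x]
    define C where "C = - (?J * (transpose_mat x * ?J))"
    have C: "C \<in> carrier_mat ?N ?N" unfolding C_def using X J
      by (intro uminus_carrier_mat mult_carrier_mat[of _ ?N ?N] transpose_carrier_mat[THEN iffD2])
    have "C * x = - (?J * (transpose_mat x * ?J) * x)"
      unfolding C_def using X J by (intro uminus_mult_left_mat) (auto simp: symp_mat_def)
    also have "?J * (transpose_mat x * ?J) * x = ?J * (transpose_mat x * ?J * x)"
      using X J by (intro assoc_mult_mat[of _ ?N ?N _ ?N _ ?N]) auto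
    also have "transpose_mat x * ?J * x = ?J"
      using x by (simp add: Sp_int_mem_iff)
    finally have Cx: "C * x = 1\<^sub>m ?N" by (simp add: symp_mat_square)
    have "?r C * ?r x = 1\<^sub>m ?N"
      using Cx of_int_hom.mat_hom_mult[OF C X, where 'a = real] by (simp add: of_int_hom.mat_hom_one)
    then have rxC: "?r x * ?r C = 1\<^sub>m ?N"
      using C X by (intro mat_mult_left_right_inverse[of "?r C" ?N]) auto
    have "symp_form n (?r C *\<^sub>v u) (?r C *\<^sub>v v) = symp_form n u v"
      if u: "u \<in> carrier_vec ?N" and v: "v \<in> carrier_vec ?N" for u v
    proof -
      have e: "?r x *\<^sub>v (?r C *\<^sub>v w) = w" if "w \<in> carrier_vec ?N" for w
        using X C that rxC assoc_mult_mat_vec[of "?r x" ?N ?N "?r C" ?N w] by simp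
      have Cw: "?r C *\<^sub>v w \<in> carrier_vec ?N" if "w \<in> carrier_vec ?N" for w
        using C that by (intro mult_mat_vec_carrier[of _ ?N ?N]) auto
      have "symp_form n (?r C *\<^sub>v u) (?r C *\<^sub>v v)
          = symp_form n (?r x *\<^sub>v (?r C *\<^sub>v u)) (?r x *\<^sub>v (?r C *\<^sub>v v))"
        using x Cw u v by (simp add: Sp_int_def)
      then show ?thesis using e u v by simp
    qed
    then have "C \<in> carrier (Sp_int n)" using C by (simp add: Sp_int_def)
    then show ?thesis using Cx by (auto simp: mult one)
  qed
qed

end

theory Submission
  imports Defs
begin

text \<open>Only \<open>n \<ge> 3 k\<close> and three generators are needed; a fourth is any further element of order \<open>k\<close>.
  Let \<open>\<sigma>\<close> permute the hyperbolic planes by a product of \<open>k\<close>-cycles on consecutive blocks, let \<open>\<tau>\<close> be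
  the same with the blocks shifted so that \<open>\<sigma>\<close> and \<open>\<tau>\<close> together act transitively, and let \<open>\<rho>\<close> be a conjugate
  \<open>u \<sigma> u\<^sup>-\<^sup>1\<close> where \<open>u\<close> is a product of four elementary maps supported in three different blocks.
  The elements \<open>\<sigma>\<^sup>-\<^sup>1 \<rho>\<close> and \<open>\<rho> \<sigma>\<^sup>-\<^sup>1\<close> are quotients of translates of \<open>u\<close>, and the positions in \<open>u\<close> are
  chosen such that their commutator is a single elementary map \<open>X\<^sub>i\<^sub>j\<close>. Transitivity spreads it to all
  \<open>X\<^sub>i\<^sub>j\<close>, that is, to \<open>SL(n, \<int>)\<close>; commutators with \<open>\<sigma>\<^sup>-\<^sup>1 \<rho>\<close> then produce the transvections
  along the coordinate axes, and Euclid's algorithm on columns shows that these maps generate.\<close>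

section \<open>Symplectic maps in coordinates\<close>

definition unit_fun :: "nat \<Rightarrow> nat \<Rightarrow> int" where
  "unit_fun j i = (if i = j then 1 else 0)"

definition mat_of :: "nat \<Rightarrow> ((nat \<Rightarrow> int) \<Rightarrow> nat \<Rightarrow> int) \<Rightarrow> int mat" where
  "mat_of n f = mat (2 * n) (2 * n) (\<lambda>(i, j). f (unit_fun j) i)"

definition lin_form :: "nat \<Rightarrow> ((nat \<Rightarrow> int) \<Rightarrow> int) \<Rightarrow> bool" where
  "lin_form N \<phi> \<longleftrightarrow> (\<exists>a. \<forall>x. \<phi> x = (\<Sum>j<N. a j * x j))"

definition int_form :: "nat \<Rightarrow> (nat \<Rightarrow> int) \<Rightarrow> (nat \<Rightarrow> int) \<Rightarrow> int" where
  "int_form n x y = (\<Sum>i<n. x i * y (n + i) - x (n + i) * y i)"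

text \<open>Vectors are total functions, so maps compose by plain \<open>\<circ>\<close>. Fixing
  every coordinate from \<open>2 * n\<close> on makes such a map determined by its matrix.\<close>

definition sp_map :: "nat \<Rightarrow> ((nat \<Rightarrow> int) \<Rightarrow> nat \<Rightarrow> int) \<Rightarrow> bool" where
  "sp_map n f \<longleftrightarrow> (\<forall>p<2*n. lin_form (2 * n) (\<lambda>x. f x p)) \<and> (\<forall>x p. 2 * n \<le> p \<longrightarrow> f x p = x p)
     \<and> (\<forall>x y. int_form n (f x) (f y) = int_form n x y)"

lemma lin_form_coord: "p < N \<Longrightarrow> lin_form N (\<lambda>x. x p)"
  unfolding lin_form_def by (rule exI[of _ "unit_fun p"]) (simp add: unit_fun_def if_distrib[of "\<lambda>a. a * _"] cong: if_cong)

lemma lin_form_add: "lin_form N \<phi> \<Longrightarrow> lin_form N \<psi> \<Longrightarrow> lin_form N (\<lambda>x. \<phi> x + \<psi> x)"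
  unfolding lin_form_def
proof (elim exE)
  fix a b assume "\<forall>x. \<phi> x = (\<Sum>j<N. a j * x j)" "\<forall>x. \<psi> x = (\<Sum>j<N. b j * x j)"
  then have "\<forall>x. \<phi> x + \<psi> x = (\<Sum>j<N. (a j + b j) * x j)"
    by (simp add: distrib_right sum.distrib)
  then show "\<exists>a. \<forall>x. \<phi> x + \<psi> x = (\<Sum>j<N. a j * x j)" by (rule exI[of _ "\<lambda>j. a j + b j"])
qed

lemma lin_form_cmult: "lin_form N \<phi> \<Longrightarrow> lin_form N (\<lambda>x. c * \<phi> x)"
  unfolding lin_form_def
proof (elim exE)
  fix a assume "\<forall>x. \<phi> x = (\<Sum>j<N. a j * x j)"
  then have "\<forall>x. c * \<phi> x = (\<Sum>j<N. (c * a j) * x j)"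
    by (simp add: sum_distrib_left mult.assoc)
  then show "\<exists>a. \<forall>x. c * \<phi> x = (\<Sum>j<N. a j * x j)" by (rule exI[of _ "\<lambda>j. c * a j"])
qed

lemma lin_form_diff: "lin_form N \<phi> \<Longrightarrow> lin_form N \<psi> \<Longrightarrow> lin_form N (\<lambda>x. \<phi> x - \<psi> x)"
  using lin_form_add[of N \<phi> "\<lambda>x. -1 * \<psi> x"] lin_form_cmult[of N \<psi> "-1"] by simp

lemma lin_form_sum:
  "(\<And>j. j < M \<Longrightarrow> lin_form N (\<phi> j)) \<Longrightarrow> lin_form N (\<lambda>x. \<Sum>j<M. \<phi> j x)" for M :: nat
proof (induction M)
  case 0
  show ?case unfolding lin_form_def by (rule exI[of _ "\<lambda>_. 0"]) simp
next
  case (Suc M)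
  then show ?case by (simp add: lin_form_add)
qed

lemmas lin_form_intros = lin_form_coord lin_form_add lin_form_diff lin_form_cmult

lemma lin_form_eq:
  assumes "lin_form N \<phi>"
  shows "\<phi> x = (\<Sum>j<N. \<phi> (unit_fun j) * x j)"
proof -
  from assms obtain a where a: "\<phi> x = (\<Sum>j<N. a j * x j)" for x
    unfolding lin_form_def by blast
  have "\<phi> (unit_fun j) = a j" if "j < N" for j
    using that by (simp add: a unit_fun_def if_distrib[of "\<lambda>b. _ * b"] cong: if_cong)
  then show ?thesis by (simp add: a)
qed

lemma sp_map_linear:
  "sp_map n f \<Longrightarrow> p < 2 * n \<Longrightarrow> f x p = (\<Sum>j<2*n. f (unit_fun j) p * x j)"
  unfolding sp_map_def by (elim conjE) (rule lin_form_eq, blast)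

lemma sp_map_id: "sp_map n id"
  by (auto simp: sp_map_def lin_form_coord)

lemma sp_map_comp:
  assumes f: "sp_map n f" and g: "sp_map n g"
  shows "sp_map n (f \<circ> g)"
proof -
  have "lin_form (2 * n) (\<lambda>x. f (g x) p)" if "p < 2 * n" for p
  proof -
    have "lin_form (2 * n) (\<lambda>x. \<Sum>j<2*n. f (unit_fun j) p * g x j)"
      using g by (intro lin_form_sum lin_form_cmult) (simp add: sp_map_def)
    then show ?thesis by (subst sp_map_linear[OF f that])
  qed
  then show ?thesis using f g by (simp add: sp_map_def)
qed

lemma mat_of_comp:
  assumes f: "sp_map n f"
  shows "mat_of n (f \<circ> g) = mat_of n f * mat_of n g"
proof (rule eq_matI)
  fix i j assume "i < dim_row (mat_of n f * mat_of n g)" "j < dim_col (mat_of n f * mat_of n g)"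
  then have ij: "i < 2 * n" "j < 2 * n" by (auto simp: mat_of_def)
  then show "mat_of n (f \<circ> g) $$ (i, j) = (mat_of n f * mat_of n g) $$ (i, j)"
    by (simp add: mat_of_def scalar_prod_def sp_map_linear[OF f, of i "g _"] atLeast0LessThan)
qed (auto simp: mat_of_def)

lemma mat_of_id: "mat_of n id = 1\<^sub>m (2 * n)"
  by (rule eq_matI) (auto simp: mat_of_def unit_fun_def)

section \<open>Symplectic matrices through the pairings of their columns\<close>

definition mat_col :: "nat \<Rightarrow> int mat \<Rightarrow> nat \<Rightarrow> nat \<Rightarrow> int" where
  "mat_col n A j p = (if p < 2 * n then A $$ (p, j) else 0)"

lemma sum_split_half: "(\<Sum>p<n + n. f p) = (\<Sum>p<n. f p) + (\<Sum>p<n. f (n + p :: nat))"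
  for f :: "nat \<Rightarrow> 'a::comm_monoid_add"
  using sum.atLeastLessThan_concat[of 0 n "n + n" f] sum.shift_bounds_nat_ivl[of f 0 n n]
  by (simp add: atLeast0LessThan add.commute)

text \<open>Left multiplication by \<open>symp_mat n\<close> exchanges the two halves of a column
  with one sign change, which turns the scalar product of columns into
  \<open>int_form\<close>.\<close>

lemma gram_entry:
  assumes A: "A \<in> carrier_mat (2 * n) (2 * n)" and ij: "i < 2 * n" "j < 2 * n"
  shows "(transpose_mat A * symp_mat n * A) $$ (i, j) = int_form n (mat_col n A i) (mat_col n A j)"
proof -
  have JA: "(symp_mat n * A) $$ (p, j) = (if p < n then A $$ (n + p, j) else - A $$ (p - n, j))"
    if p: "p < 2 * n" for p
  proof -
    have "(symp_mat n * A) $$ (p, j) = (\<Sum>l = 0..<2 * n. symp_mat n $$ (p, l) * A $$ (l, j))"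
      using A p ij by (simp add: symp_mat_def scalar_prod_def)
    also have "\<dots> = (\<Sum>l = 0..<2 * n. if l = (if p < n then n + p else p - n)
        then (if p < n then A $$ (n + p, j) else - A $$ (p - n, j)) else 0)"
      using p by (intro sum.cong refl) (auto simp: symp_mat_def)
    also have "\<dots> = (if p < n then A $$ (n + p, j) else - A $$ (p - n, j))"
      using p by (subst sum.delta) auto
    finally show ?thesis .
  qed
  have "(transpose_mat A * symp_mat n * A) $$ (i, j) = (transpose_mat A * (symp_mat n * A)) $$ (i, j)"
    using A by (subst assoc_mult_mat[of _ "2 * n" "2 * n" _ "2 * n" _ "2 * n"]) auto
  also have "\<dots> = (\<Sum>p = 0..<n + n. A $$ (p, i) * (symp_mat n * A) $$ (p, j))"
    using A ij by (simp add: scalar_prod_def symp_mat_def mult_2)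
  also have "\<dots> = (\<Sum>p<n + n. A $$ (p, i) * (if p < n then A $$ (n + p, j) else - A $$ (p - n, j)))"
    using JA by (simp add: atLeast0LessThan)
  also have "\<dots> = (\<Sum>p<n. A $$ (p, i) * A $$ (n + p, j)) + (\<Sum>p<n. A $$ (n + p, i) * - A $$ (p, j))"
    by (simp add: sum_split_half sum_negf)
  also have "\<dots> = int_form n (mat_col n A i) (mat_col n A j)"
    by (simp add: int_form_def sum_subtractf sum_negf mat_col_def)
  finally show ?thesis .
qed

lemma symp_mat_entry:
  assumes ij: "i < 2 * n" "j < 2 * n"
  shows "symp_mat n $$ (i, j) = int_form n (unit_fun i) (unit_fun j)"
proof -
  have "transpose_mat (1\<^sub>m (2 * n)) * symp_mat n * 1\<^sub>m (2 * n) = symp_mat n"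
    using left_mult_one_mat[OF symp_mat_carrier] right_mult_one_mat[OF symp_mat_carrier] by simp
  moreover have "int_form n (mat_col n (1\<^sub>m (2 * n)) i) (mat_col n (1\<^sub>m (2 * n)) j)
      = int_form n (unit_fun i) (unit_fun j)"
    unfolding int_form_def using ij
    by (intro sum.cong refl arg_cong2[of _ _ _ _ "(-)"] arg_cong2[of _ _ _ _ "(*)"])
       (auto simp: mat_col_def unit_fun_def)
  ultimately show ?thesis using gram_entry[of "1\<^sub>m (2 * n)" n i j] ij by simp
qed

text \<open>This is the form in which membership is used: the columns are a symplectic basis, and
  maps act on them one column at a time.\<close>

lemma Sp_int_iff_cols:
  "A \<in> carrier (Sp_int n) \<longleftrightarrow> A \<in> carrier_mat (2 * n) (2 * n) \<and>
     (\<forall>i<2*n. \<forall>j<2*n. int_form n (mat_col n A i) (mat_col n A j) = int_form n (unit_fun i) (unit_fun j))"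
proof (cases "A \<in> carrier_mat (2 * n) (2 * n)")
  case True
  have "transpose_mat A * symp_mat n * A = symp_mat n \<longleftrightarrow>
      (\<forall>i<2*n. \<forall>j<2*n. (transpose_mat A * symp_mat n * A) $$ (i, j) = symp_mat n $$ (i, j))"
    using True by (auto intro!: eq_matI simp: symp_mat_def simp del: index_mult_mat(1))
  then show ?thesis using True by (simp add: Sp_int_mem_iff gram_entry symp_mat_entry del: index_mult_mat(1))
qed (simp add: Sp_int_mem_iff)

lemma mat_col_mult:
  assumes f: "sp_map n f" and A: "A \<in> carrier_mat (2 * n) (2 * n)" and j: "j < 2 * n"
  shows "mat_col n (mat_of n f * A) j = f (mat_col n A j)"
proof
  fix p
  show "mat_col n (mat_of n f * A) j p = f (mat_col n A j) p"
  proof (cases "p < 2 * n")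
    case True
    then show ?thesis using A j sp_map_linear[OF f True, of "mat_col n A j"]
      by (simp add: mat_col_def mat_of_def scalar_prod_def atLeast0LessThan)
  qed (use f in \<open>simp add: sp_map_def mat_col_def\<close>)
qed

lemma mat_col_mat_of:
  assumes f: "sp_map n f" and j: "j < 2 * n"
  shows "mat_col n (mat_of n f) j = f (unit_fun j)"
  using assms by (auto simp: fun_eq_iff mat_col_def mat_of_def sp_map_def unit_fun_def)

lemma mat_of_Sp: "sp_map n f \<Longrightarrow> mat_of n f \<in> carrier (Sp_int n)"
  by (auto simp: Sp_int_iff_cols mat_col_mat_of) (auto simp: sp_map_def mat_of_def)

section \<open>Elementary symplectic maps\<close>

text \<open>The block-diagonal matrix with blocks M = 1 + c E_ij and the inverse transpose of M;
  these maps generate the copy of SL(n).\<close>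

definition addX :: "nat \<Rightarrow> nat \<Rightarrow> nat \<Rightarrow> int \<Rightarrow> (nat \<Rightarrow> int) \<Rightarrow> nat \<Rightarrow> int" where
  "addX n i j c x = x(i := x i + c * x j, n + j := x (n + j) - c * x (n + i))"

definition addY :: "nat \<Rightarrow> nat \<Rightarrow> int \<Rightarrow> (nat \<Rightarrow> int) \<Rightarrow> nat \<Rightarrow> int" where
  "addY n i c x = x(i := x i + c * x (n + i))"

definition addZ :: "nat \<Rightarrow> nat \<Rightarrow> int \<Rightarrow> (nat \<Rightarrow> int) \<Rightarrow> nat \<Rightarrow> int" where
  "addZ n i c x = x(n + i := x (n + i) + c * x i)"

text \<open>Permutations act by pulling back coordinates, so \<open>\<pi>\<close> is composed in reverse order and no inverse
  occurs in the commutation rules.\<close>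

definition permP :: "nat \<Rightarrow> (nat \<Rightarrow> nat) \<Rightarrow> (nat \<Rightarrow> int) \<Rightarrow> nat \<Rightarrow> int" where
  "permP n \<pi> x p = (if p < n then x (\<pi> p) else if p < 2 * n then x (n + \<pi> (p - n)) else x p)"

lemma sp_map_addX:
  assumes ij: "i < n" "j < n" "i \<noteq> j"
  shows "sp_map n (addX n i j c)"
proof -
  have "lin_form (2 * n) (\<lambda>x. addX n i j c x p)" if "p < 2 * n" for p
    using ij that
    by (cases "p = i"; cases "p = n + j") (auto simp: addX_def intro!: lin_form_intros)
  moreover have "int_form n (addX n i j c x) (addX n i j c y) = int_form n x y" for x y
  proof -
    \<comment> \<open>Only the planes \<open>i\<close> and \<open>j\<close> contribute a change, and
      their two changes are opposite.\<close>
    let ?D = "c * (x j * y (n + i) - x (n + i) * y j)"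
    have "int_form n (addX n i j c x) (addX n i j c y) = (\<Sum>p<n. x p * y (n + p) - x (n + p) * y p
        + (if p = i then ?D else 0) + (if p = j then - ?D else 0))"
      unfolding int_form_def using ij
      by (intro sum.cong refl) (auto simp: addX_def algebra_simps)
    also have "\<dots> = int_form n x y"
      unfolding int_form_def using ij by (simp only: sum.distrib sum.delta finite_lessThan) simp
    finally show ?thesis .
  qed
  ultimately show ?thesis using ij by (auto simp: sp_map_def addX_def)
qed

lemma sp_map_addY:
  assumes i: "i < n"
  shows "sp_map n (addY n i c)"
proof -
  have "lin_form (2 * n) (\<lambda>x. addY n i c x p)" if "p < 2 * n" for p
    using i that by (cases "p = i") (auto simp: addY_def intro!: lin_form_intros)
  moreover have "int_form n (addY n i c x) (addY n i c y) = int_form n x y" for x y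
    unfolding int_form_def using i
    by (intro sum.cong refl) (auto simp: addY_def algebra_simps)
  ultimately show ?thesis using i by (auto simp: sp_map_def addY_def)
qed

lemma sp_map_addZ:
  assumes i: "i < n"
  shows "sp_map n (addZ n i c)"
proof -
  have "lin_form (2 * n) (\<lambda>x. addZ n i c x p)" if "p < 2 * n" for p
    using i that by (cases "p = n + i") (auto simp: addZ_def intro!: lin_form_intros)
  moreover have "int_form n (addZ n i c x) (addZ n i c y) = int_form n x y" for x y
    unfolding int_form_def using i
    by (intro sum.cong refl) (auto simp: addZ_def algebra_simps)
  ultimately show ?thesis using i by (auto simp: sp_map_def addZ_def)
qed

lemma sp_map_permP:
  assumes \<pi>: "bij_betw \<pi> {..<n} {..<n}"
  shows "sp_map n (permP n \<pi>)"
proof -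
  have lt: "\<pi> p < n" if "p < n" for p
    using bij_betwE[OF \<pi>] that by auto
  have "lin_form (2 * n) (\<lambda>x. permP n \<pi> x p)" if "p < 2 * n" for p
  proof (cases "p < n")
    case True
    then show ?thesis using lt[of p] by (auto simp: permP_def intro!: lin_form_coord)
  next
    case False
    then show ?thesis using lt[of "p - n"] that by (auto simp: permP_def intro!: lin_form_coord)
  qed
  moreover have "int_form n (permP n \<pi> x) (permP n \<pi> y) = int_form n x y" for x y
    unfolding int_form_def
    using sum.reindex_bij_betw[OF \<pi>, of "\<lambda>i. x i * y (n + i) - x (n + i) * y i"]
    by (simp add: permP_def)
  ultimately show ?thesis by (auto simp: sp_map_def permP_def)
qed

lemma addX_add: "i \<noteq> j \<Longrightarrow> i < n \<Longrightarrow> j < n \<Longrightarrow> addX n i j c \<circ> addX n i j d = addX n i j (c + d)"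
  by (auto simp: addX_def fun_eq_iff algebra_simps)

lemma addY_add: "i < n \<Longrightarrow> addY n i c \<circ> addY n i d = addY n i (c + d)"
  by (auto simp: addY_def fun_eq_iff algebra_simps)

lemma addZ_add: "i < n \<Longrightarrow> addZ n i c \<circ> addZ n i d = addZ n i (c + d)"
  by (auto simp: addZ_def fun_eq_iff algebra_simps)

lemma add_zero [simp]: "addX n i j 0 = id" "addY n i 0 = id" "addZ n i 0 = id"
  by (auto simp: addX_def addY_def addZ_def)

section \<open>Permutations of the hyperbolic planes\<close>

lemma permD:
  assumes "bij_betw \<pi> {..<n} {..<n}"
  shows "p < n \<Longrightarrow> \<pi> p < n" and "p < n \<Longrightarrow> q < n \<Longrightarrow> \<pi> p = \<pi> q \<longleftrightarrow> p = q"
  using bij_betwE[OF assms] bij_betw_imp_inj_on[OF assms] by (auto simp: inj_on_eq_iff)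

lemma perm_ext:
  assumes "bij_betw \<pi> {..<n} {..<n}"
    and "\<And>x p. p < n \<Longrightarrow> \<pi> p < n \<Longrightarrow> F x p = G x p"
    and "\<And>x p. p < n \<Longrightarrow> \<pi> p < n \<Longrightarrow> F x (n + p) = G x (n + p)"
    and "\<And>x p. 2 * n \<le> p \<Longrightarrow> F x p = G x p"
  shows "F = (G :: (nat \<Rightarrow> int) \<Rightarrow> nat \<Rightarrow> int)"
proof (intro ext)
  fix x p
  consider "p < n" | q where "q < n" "p = n + q" | "2 * n \<le> p"
  proof (cases "p < n \<or> 2 * n \<le> p")
    case False
    then have "p - n < n" "p = n + (p - n)" by auto
    then show ?thesis using that(2) by blast
  qed (use that in auto)
  then show "F x p = G x p" using assms permD(1)[OF assms(1)] by cases auto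
qed

lemma permP_apply:
  "p < n \<Longrightarrow> permP n \<pi> x p = x (\<pi> p)"
  "p < n \<Longrightarrow> permP n \<pi> x (n + p) = x (n + \<pi> p)"
  "2 * n \<le> p \<Longrightarrow> permP n \<pi> x p = x p"
  by (auto simp: permP_def)

lemma permP_comp:
  assumes "bij_betw \<pi> {..<n} {..<n}"
  shows "permP n \<pi> \<circ> permP n \<tau> = permP n (\<tau> \<circ> \<pi>)"
  by (rule perm_ext[OF assms]) (simp_all add: permP_apply)

lemma permP_id: "(\<And>i. i < n \<Longrightarrow> \<pi> i = i) \<Longrightarrow> permP n \<pi> = id"
  by (auto simp: permP_def fun_eq_iff)

lemma permP_inverse:
  assumes \<pi>: "bij_betw \<pi> {..<n} {..<n}"
  obtains f where "sp_map n f" "permP n \<pi> \<circ> f = id" "f \<circ> permP n \<pi> = id"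
proof
  let ?\<tau> = "inv_into {..<n} \<pi>"
  have \<tau>: "bij_betw ?\<tau> {..<n} {..<n}" using bij_betw_inv_into[OF \<pi>] .
  show "sp_map n (permP n ?\<tau>)" using sp_map_permP[OF \<tau>] .
  show "permP n \<pi> \<circ> permP n ?\<tau> = id"
    using \<pi> by (subst permP_comp[OF \<pi>]) (auto intro!: permP_id simp: bij_betw_inv_into_left)
  show "permP n ?\<tau> \<circ> permP n \<pi> = id"
    using \<pi> by (subst permP_comp[OF \<tau>]) (auto intro!: permP_id simp: bij_betw_inv_into_right)
qed

lemma permP_addX:
  assumes \<pi>: "bij_betw \<pi> {..<n} {..<n}" and ij: "i < n" "j < n"
  shows "permP n \<pi> \<circ> addX n (\<pi> i) (\<pi> j) c = addX n i j c \<circ> permP n \<pi>"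
  using ij permD(1)[OF \<pi> ij(1)] permD(1)[OF \<pi> ij(2)]
  by (intro perm_ext[OF \<pi>]) (simp_all add: permP_apply addX_def permD(2)[OF \<pi>])

lemma permP_addY:
  assumes \<pi>: "bij_betw \<pi> {..<n} {..<n}" and ij: "i < n"
  shows "permP n \<pi> \<circ> addY n (\<pi> i) c = addY n i c \<circ> permP n \<pi>"
  using ij permD(1)[OF \<pi> ij]
  by (intro perm_ext[OF \<pi>]) (simp_all add: permP_apply addY_def permD(2)[OF \<pi>])

lemma permP_addZ:
  assumes \<pi>: "bij_betw \<pi> {..<n} {..<n}" and ij: "i < n"
  shows "permP n \<pi> \<circ> addZ n (\<pi> i) c = addZ n i c \<circ> permP n \<pi>"
  using ij permD(1)[OF \<pi> ij]
  by (intro perm_ext[OF \<pi>]) (simp_all add: permP_apply addZ_def permD(2)[OF \<pi>])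

section \<open>Generation by elementary maps\<close>

lemma int_form_unit:
  "i < n \<Longrightarrow> int_form n (unit_fun i) x = x (n + i)"
  "i < n \<Longrightarrow> int_form n (unit_fun (n + i)) x = - x i"
proof -
  assume i: "i < n"
  have "int_form n (unit_fun i) x = (\<Sum>p<n. if p = i then x (n + p) else 0)"
    unfolding int_form_def using i by (intro sum.cong refl) (auto simp: unit_fun_def)
  then show "int_form n (unit_fun i) x = x (n + i)" using i by simp
  have "int_form n (unit_fun (n + i)) x = (\<Sum>p<n. if p = i then - x p else 0)"
    unfolding int_form_def using i by (intro sum.cong refl) (auto simp: unit_fun_def)
  then show "int_form n (unit_fun (n + i)) x = - x i" using i by simp
qed

text \<open>Euclid's algorithm by shears alone: each round sends (a, b) to (b, -r) with r the
  remainder. \<open>T\<close> is abstract because the pair may be two coordinates of one plane or of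
  two planes.\<close>

lemma euclid_pairs:
  fixes T :: "int \<times> int \<Rightarrow> int \<times> int \<Rightarrow> bool"
  assumes refl: "\<And>s. T s s" and trans: "\<And>s t u. T s t \<Longrightarrow> T t u \<Longrightarrow> T s u"
    and step1: "\<And>a b c. T (a, b) (a + c * b, b)" and step2: "\<And>a b c. T (a, b) (a, b + c * a)"
  shows "\<exists>d. T (a, b) (d, 0)"
proof (induction "nat \<bar>b\<bar>" arbitrary: a b rule: less_induct)
  case less
  show ?case
  proof (cases "b = 0")
    case True
    then show ?thesis using refl by blast
  next
    case False
    define r where "r = a mod b"
    \<comment> \<open>The quotient is taken one too small, leaving \<open>r + b\<close>; subtracting
      this from \<open>b\<close> gives \<open>- r\<close>, and adding that back gives
      \<open>b\<close>.\<close>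
    have a: "a + (1 - a div b) * b = r + b"
      by (simp add: r_def algebra_simps flip: minus_div_mult_eq_mod)
    have "T (a, b) (r + b, b)" using step1[of a b "1 - a div b"] a by simp
    moreover have "T (r + b, b) (r + b, - r)" using step2[of "r + b" b "-1"] by simp
    moreover have "T (r + b, - r) (b, - r)" using step1[of "r + b" "- r" 1] by simp
    ultimately have 1: "T (a, b) (b, - r)" using trans by blast
    have "nat \<bar>- r\<bar> < nat \<bar>b\<bar>" using False by (simp add: r_def abs_mod_less)
    from less[OF this] obtain d where "T (b, - r) (d, 0)" by blast
    then show ?thesis using 1 trans by blast
  qed
qed

section \<open>Subgroups seen through the maps they contain\<close>

locale sp_subgroup =
  fixes n :: nat and G :: "int mat set"
  assumes subgroup: "subgroup G (Sp_int n)"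
begin

definition good :: "((nat \<Rightarrow> int) \<Rightarrow> nat \<Rightarrow> int) \<Rightarrow> bool" where
  "good f \<longleftrightarrow> sp_map n f \<and> mat_of n f \<in> G"

lemma good_sp_map: "good f \<Longrightarrow> sp_map n f"
  by (simp add: good_def)

lemma good_id: "good id"
  using subgroup.one_closed[OF subgroup] by (simp add: good_def sp_map_id mat_of_id Sp_int_def)

lemma good_comp: "good f \<Longrightarrow> good g \<Longrightarrow> good (f \<circ> g)"
  using subgroup.m_closed[OF subgroup, of "mat_of n f" "mat_of n g"]
  by (simp add: good_def sp_map_comp mat_of_comp Sp_int_def)

lemma left_inverse_mem:
  assumes A: "A \<in> carrier (Sp_int n)" and B: "B \<in> G" and BA: "B * A = 1\<^sub>m (2 * n)"
  shows "A \<in> G"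
proof -
  interpret group "Sp_int n" by (rule group_Sp_int)
  have "B \<in> carrier (Sp_int n)" using subgroup.mem_carrier[OF subgroup B] .
  moreover have "B \<otimes>\<^bsub>Sp_int n\<^esub> A = \<one>\<^bsub>Sp_int n\<^esub>" using BA by (simp add: Sp_int_def)
  ultimately have "A = inv\<^bsub>Sp_int n\<^esub> B" using A by (metis inv_equality inv_inv inv_closed)
  then show ?thesis using subgroup.m_inv_closed[OF subgroup B] by simp
qed

lemma good_inverse:
  assumes "good f" "sp_map n f'" "f \<circ> f' = id"
  shows "good f'"
  using left_inverse_mem[of "mat_of n f'" "mat_of n f"] assms mat_of_comp[of n f f']
  by (simp add: good_def mat_of_Sp mat_of_id)

lemma good_commutator:
  assumes "good f" "good g" "sp_map n f'" "sp_map n g'" "f \<circ> f' = id" "g \<circ> g' = id"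
  shows "good (f \<circ> g \<circ> f' \<circ> g')"
  using assms by (intro good_comp) (auto intro: good_inverse)

text \<open>\<open>V\<close> holds the columns already in normal form, which every later move must
  fix.\<close>

definition reach :: "(nat \<Rightarrow> int) set \<Rightarrow> (nat \<Rightarrow> int) \<Rightarrow> (nat \<Rightarrow> int) \<Rightarrow> bool" where
  "reach V x y \<longleftrightarrow> (\<exists>f. good f \<and> (\<forall>v\<in>V. f v = v) \<and> f x = y)"

lemma reach_refl: "reach V x x"
  unfolding reach_def by (rule exI[of _ id]) (simp add: good_id)

lemma reach_trans: "reach V x y \<Longrightarrow> reach V y z \<Longrightarrow> reach V x z"
  unfolding reach_def
proof (elim exE conjE)
  fix f g assume "good f" "\<forall>v\<in>V. f v = v" "f x = y" "good g" "\<forall>v\<in>V. g v = v" "g y = z"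
  then show "\<exists>f. good f \<and> (\<forall>v\<in>V. f v = v) \<and> f x = z"
    by (intro exI[of _ "g \<circ> f"]) (simp add: good_comp)
qed

end

locale elementary_sp_subgroup = sp_subgroup +
  assumes good_addX: "i < n \<Longrightarrow> j < n \<Longrightarrow> i \<noteq> j \<Longrightarrow> good (addX n i j c)"
    and good_addY: "i < n \<Longrightarrow> good (addY n i c)"
    and good_addZ: "i < n \<Longrightarrow> good (addZ n i c)"
begin

text \<open>\<open>addX n i j c\<close> reads only the coordinates \<open>j\<close> and
  \<open>n + i\<close>, so it fixes every vector vanishing there.\<close>

lemma reach_addX:
  assumes "i < n" "j < n" "i \<noteq> j" "\<forall>v\<in>V. v j = 0 \<and> v (n + i) = 0"
  shows "reach V x (addX n i j c x)"
  unfolding reach_def using assms by (intro exI[of _ "addX n i j c"]) (auto simp: good_addX addX_def)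

lemma reach_addY:
  assumes "i < n" "\<forall>v\<in>V. v (n + i) = 0"
  shows "reach V x (addY n i c x)"
  unfolding reach_def using assms by (intro exI[of _ "addY n i c"]) (auto simp: good_addY addY_def)

lemma reach_addZ:
  assumes "i < n" "\<forall>v\<in>V. v i = 0"
  shows "reach V x (addZ n i c x)"
  unfolding reach_def using assms by (intro exI[of _ "addZ n i c"]) (auto simp: good_addZ addZ_def)

lemma reach_pairs:
  assumes "p \<noteq> q"
    and "\<And>a b c. reach V (x(p := a, q := b)) (x(p := a + c * b, q := b))"
    and "\<And>a b c. reach V (x(p := a, q := b)) (x(p := a, q := b + c * a))"
  shows "\<exists>d. reach V x (x(p := d, q := 0))"
proof -
  have "\<exists>d. (\<lambda>s t. reach V (x(p := fst s, q := snd s)) (x(p := fst t, q := snd t))) (x p, x q) (d, 0)"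
    by (rule euclid_pairs) (unfold fst_conv snd_conv, rule reach_refl, erule (1) reach_trans, rule assms(2), rule assms(3))
  then show ?thesis by simp
qed

lemma reach_plane:
  assumes i: "i < n" and V: "\<forall>v\<in>V. v i = 0 \<and> v (n + i) = 0"
  shows "reach V (x(i := a, n + i := b)) (x(i := a + c * b, n + i := b))"
    and "reach V (x(i := a, n + i := b)) (x(i := a, n + i := b + c * a))"
  using reach_addY[of i V "x(i := a, n + i := b)" c] reach_addZ[of i V "x(i := a, n + i := b)" c] i V
  by (auto simp: addY_def addZ_def fun_upd_twist)

lemma reach_plane_upper:
  assumes "i < n" "\<forall>v\<in>V. v i = 0 \<and> v (n + i) = 0"
  shows "\<exists>d. reach V x (x(i := d, n + i := 0))"
  using assms reach_plane[OF assms] by (intro reach_pairs) auto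

lemma reach_plane_lower:
  assumes "i < n" "\<forall>v\<in>V. v i = 0 \<and> v (n + i) = 0"
  shows "\<exists>d. reach V x (x(i := 0, n + i := d))"
proof -
  have "\<exists>d. reach V x (x(n + i := d, i := 0))"
    using assms reach_plane[OF assms] by (intro reach_pairs) (auto simp: fun_upd_twist[of "n + i" i])
  then show ?thesis using assms by (simp add: fun_upd_twist[of "n + i" i])
qed

section \<open>Reducing the columns of a symplectic matrix\<close>

definition supported :: "nat \<Rightarrow> (nat \<Rightarrow> int) \<Rightarrow> bool" where
  "supported t x \<longleftrightarrow> (\<forall>p. (\<forall>i. t \<le> i \<and> i < n \<longrightarrow> p \<noteq> i \<and> p \<noteq> n + i) \<longrightarrow> x p = 0)"

lemma supported_upd:
  assumes "supported t x" "t \<le> i" "i < n"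
  shows "supported t (x(i := a))" "supported t (x(n + i := a))"
  using assms unfolding supported_def by auto

text \<open>Complementary to \<open>supported t\<close>: moves that use only planes from
  \<open>t\<close> on fix all of \<open>V\<close>.\<close>

definition vanishing :: "nat \<Rightarrow> (nat \<Rightarrow> int) set \<Rightarrow> bool" where
  "vanishing t V \<longleftrightarrow> (\<forall>v\<in>V. \<forall>i. t \<le> i \<and> i < n \<longrightarrow> v i = 0 \<and> v (n + i) = 0)"

text \<open>Euclid inside one plane after another, by \<open>addY\<close> and \<open>addZ\<close>,
  collects the content of each plane in its upper coordinate.\<close>

lemma clear_upper:
  assumes "vanishing t V" "supported t x" "m \<le> n"
  shows "\<exists>y. reach V x y \<and> supported t y \<and> (\<forall>i. t \<le> i \<and> i < m \<longrightarrow> y (n + i) = 0)"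
  using assms(3)
proof (induction m)
  case 0
  then show ?case using assms reach_refl by auto
next
  case (Suc m)
  then obtain y where y: "reach V x y" "supported t y" "\<And>i. t \<le> i \<Longrightarrow> i < m \<Longrightarrow> y (n + i) = 0"
    by auto
  show ?case
  proof (cases "t \<le> m")
    case True
    then obtain d where d: "reach V y (y(m := d, n + m := 0))"
      using reach_plane_upper[of m V y] Suc.prems assms by (auto simp: vanishing_def)
    show ?thesis
      using y(2,3) True Suc.prems
      by (intro exI[of _ "y(m := d, n + m := 0)"] conjI reach_trans[OF y(1) d] supported_upd)
         (auto simp: less_Suc_eq)
  next
    case False
    then show ?thesis using y by (intro exI[of _ y]) auto
  qed
qed

text \<open>With the lower coordinates already zero, the dual action of \<open>addX\<close> is
  invisible, so Euclid can run between coordinates \<open>t\<close> and \<open>m\<close>.\<close>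

lemma clear_lower:
  assumes V: "vanishing t V" and "supported t x" "\<And>i. t \<le> i \<Longrightarrow> i < n \<Longrightarrow> x (n + i) = 0"
    and "m \<le> n" "t < n"
  shows "\<exists>y. reach V x y \<and> supported t y \<and> (\<forall>i. t \<le> i \<and> i < n \<longrightarrow> y (n + i) = 0) \<and>
    (\<forall>i. t < i \<and> i < m \<longrightarrow> y i = 0)"
  using assms(4)
proof (induction m)
  case 0
  then show ?case using assms reach_refl by auto
next
  case (Suc m)
  then obtain y where y: "reach V x y" "supported t y" "\<And>i. t \<le> i \<Longrightarrow> i < n \<Longrightarrow> y (n + i) = 0"
      "\<And>i. t < i \<Longrightarrow> i < m \<Longrightarrow> y i = 0"
    by auto
  show ?case
  proof (cases "t < m")
    case True
    have m: "m < n" using Suc.prems by simp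
    have V': "\<forall>v\<in>V. v t = 0 \<and> v (n + t) = 0" "\<forall>v\<in>V. v m = 0 \<and> v (n + m) = 0"
      using V True m \<open>t < n\<close> by (auto simp: vanishing_def)
    have "\<exists>d. reach V y (y(t := d, m := 0))"
    proof (rule reach_pairs)
      fix a b c
      show "reach V (y(t := a, m := b)) (y(t := a + c * b, m := b))"
        using reach_addX[of t m V "y(t := a, m := b)" c] y(3)[of t] y(3)[of m] True m V' \<open>t < n\<close>
        by (simp add: addX_def fun_upd_twist fun_upd_idem)
      show "reach V (y(t := a, m := b)) (y(t := a, m := b + c * a))"
        using reach_addX[of m t V "y(t := a, m := b)" c] y(3)[of t] y(3)[of m] True m V' \<open>t < n\<close>
        by (simp add: addX_def fun_upd_twist fun_upd_idem)
    qed (use True in simp)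
    then obtain d where d: "reach V y (y(t := d, m := 0))" by blast
    show ?thesis
      using y(2-4) True m \<open>t < n\<close>
      by (intro exI[of _ "y(t := d, m := 0)"] conjI reach_trans[OF y(1) d] supported_upd)
         (auto simp: less_Suc_eq)
  next
    case False
    then show ?thesis using y by (intro exI[of _ y]) (auto simp: less_Suc_eq)
  qed
qed

lemma reach_int_form:
  "reach V x y \<Longrightarrow> \<exists>w'. int_form n y w' = int_form n x w"
  unfolding reach_def good_def sp_map_def by blast

text \<open>After both clearings only the multiple \<open>z t\<close> of the basis vector remains. A
  pairing with value 1 survives all moves and is divisible by \<open>z t\<close>, so
  \<open>z t\<close> is 1 or -1.\<close>

lemma reach_unit:
  assumes V: "vanishing t V" and x: "supported t x" "int_form n x w = 1" and t: "t < n"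
  shows "reach V x (unit_fun t)"
proof -
  obtain y where y: "reach V x y" "supported t y" "\<And>i. t \<le> i \<Longrightarrow> i < n \<Longrightarrow> y (n + i) = 0"
    using clear_upper[OF V x(1), of n] by auto
  obtain z where z: "reach V y z" "supported t z" "\<And>i. t \<le> i \<Longrightarrow> i < n \<Longrightarrow> z (n + i) = 0"
      "\<And>i. t < i \<Longrightarrow> i < n \<Longrightarrow> z i = 0"
    using clear_lower[OF V y(2,3) _ t, of n] by auto
  have xz: "reach V x z" using y z reach_trans by blast
  have zp: "z p = z t * unit_fun t p" for p
  proof (cases "p = t \<or> (\<forall>i. t \<le> i \<and> i < n \<longrightarrow> p \<noteq> i \<and> p \<noteq> n + i)")
    case True
    then show ?thesis using z(2)[unfolded supported_def, rule_format, of p] by (cases "p = t") (auto simp: unit_fun_def)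
  next
    case False
    then obtain i where "p \<noteq> t" "t \<le> i" "i < n" "p = i \<or> p = n + i" by blast
    then show ?thesis using z(3)[of i] z(4)[of i] by (auto simp: unit_fun_def)
  qed
  obtain w' where w': "int_form n z w' = 1" using reach_int_form[OF xz, of w] x by auto
  have "int_form n z w' = z t * int_form n (unit_fun t) w'"
    unfolding int_form_def sum_distrib_left
    by (intro sum.cong refl) (subst (1 2) zp, simp add: algebra_simps)
  then have "z t dvd 1" using w' by (metis dvd_triv_left)
  then have "z t = 1 \<or> z t = - 1" by auto
  moreover have "z = unit_fun t" if "z t = 1"
  proof
    fix p show "z p = unit_fun t p" using zp[of p] that by simp
  qed
  moreover have "reach V z (unit_fun t)" if zt: "z t = - 1"
  proof -
    have V': "\<forall>v\<in>V. v t = 0 \<and> v (n + t) = 0" using V t by (auto simp: vanishing_def)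
    note r = reach_plane[OF t V', of z]
    \<comment> \<open>The sign is changed by three shears in one plane: (-1, 0), (-1, 1), (1, 1),
      (1, 0).\<close>
    have "reach V (z(t := -1, n + t := 0)) (z(t := -1, n + t := 1))" using r(2)[of "-1" 0 "-1"] by simp
    moreover have "reach V (z(t := -1, n + t := 1)) (z(t := 1, n + t := 1))" using r(1)[of "-1" 1 2] by simp
    moreover have "reach V (z(t := 1, n + t := 1)) (z(t := 1, n + t := 0))" using r(2)[of 1 1 "-1"] by simp
    ultimately have "reach V (z(t := -1, n + t := 0)) (z(t := 1, n + t := 0))" using reach_trans by blast
    moreover have "z(t := -1, n + t := 0) = z" using zt z(3)[OF _ t] by auto
    moreover have "z(t := 1, n + t := 0) = unit_fun t"
    proof
      fix p
      show "(z(t := 1, n + t := 0)) p = unit_fun t p"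
        using zp[of p] t by (auto simp: unit_fun_def)
    qed
    ultimately show ?thesis by simp
  qed
  ultimately show ?thesis using xz reach_trans by blast
qed

text \<open>The moves must also fix \<open>unit_fun t\<close>, so coordinate \<open>t\<close> may be
  written but not read. The entry 1 at \<open>n + t\<close> is the pivot:
  \<open>addX n t m d\<close> clears plane \<open>m\<close> once its content is in the lower
  coordinate, and \<open>addY\<close> finally clears coordinate \<open>t\<close>.\<close>

lemma reach_dual_unit:
  assumes V: "vanishing t V" and x: "supported t x" "x (n + t) = 1" and t: "t < n"
  shows "reach (insert (unit_fun t) V) x (unit_fun (n + t))"
proof -
  let ?W = "insert (unit_fun t) V"
  have "\<exists>y. reach ?W x y \<and> supported t y \<and> y (n + t) = 1 \<and>
      (\<forall>i. t < i \<and> i < m \<longrightarrow> y i = 0 \<and> y (n + i) = 0)" if "m \<le> n" for m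
    using that
  proof (induction m)
    case 0
    then show ?case using x reach_refl by auto
  next
    case (Suc m)
    then obtain y where y: "reach ?W x y" "supported t y" "y (n + t) = 1"
      "\<And>i. t < i \<Longrightarrow> i < m \<Longrightarrow> y i = 0 \<and> y (n + i) = 0" by auto
    show ?case
    proof (cases "t < m")
      case True
      have m: "m < n" using Suc.prems by simp
      have W: "\<forall>v\<in>?W. v m = 0 \<and> v (n + m) = 0 \<and> v (n + t) = 0"
        using V True m t by (auto simp: vanishing_def unit_fun_def)
      obtain d where d: "reach ?W y (y(m := 0, n + m := d))"
        using reach_plane_lower[OF m, of ?W y] W by auto
      have "reach ?W (y(m := 0, n + m := d)) (addX n t m d (y(m := 0, n + m := d)))"
        using W m t True by (intro reach_addX) auto
      also have "addX n t m d (y(m := 0, n + m := d)) = y(m := 0, n + m := 0)"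
        using y(3) True m t by (auto simp: addX_def fun_eq_iff)
      finally have r: "reach ?W x (y(m := 0, n + m := 0))" using reach_trans[OF y(1) reach_trans[OF d]] by blast
      show ?thesis
        using y(2-4) True m t
        by (intro exI[of _ "y(m := 0, n + m := 0)"] conjI supported_upd r) (auto simp: less_Suc_eq)
    next
      case False
      then show ?thesis using y by (intro exI[of _ y]) (auto simp: less_Suc_eq)
    qed
  qed
  from this[of n] obtain y where y: "reach ?W x y" "supported t y" "y (n + t) = 1"
      "\<And>i. t < i \<Longrightarrow> i < n \<Longrightarrow> y i = 0 \<and> y (n + i) = 0" by auto
  have "reach ?W y (addY n t (- y t) y)"
    using V t by (intro reach_addY) (auto simp: vanishing_def unit_fun_def)
  also have "addY n t (- y t) y = unit_fun (n + t)"
  proof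
    fix p
    show "addY n t (- y t) y p = unit_fun (n + t) p"
    proof (cases "\<forall>i. t \<le> i \<and> i < n \<longrightarrow> p \<noteq> i \<and> p \<noteq> n + i")
      case True
      then have "p \<noteq> t" "p \<noteq> n + t" "y p = 0" using t y(2) by (auto simp: supported_def)
      then show ?thesis by (simp add: addY_def unit_fun_def)
    next
      case False
      then obtain i where "t \<le> i" "i < n" "p = i \<or> p = n + i" by blast
      then show ?thesis using y(3) t y(4)[of i] by (cases "i = t") (auto simp: addY_def unit_fun_def)
    qed
  qed
  finally show ?thesis using y(1) reach_trans by blast
qed

text \<open>Induction over hyperbolic pairs. As pairings are preserved, columns \<open>t\<close> and
  \<open>n + t\<close> become orthogonal to the pairs already normalised and hence live in the
  remaining planes.\<close>

lemma reduce_columns: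
  assumes A: "A \<in> carrier (Sp_int n)" and "t \<le> n"
  shows "\<exists>f. good f \<and> (\<forall>j<t. f (mat_col n A j) = unit_fun j \<and> f (mat_col n A (n + j)) = unit_fun (n + j))"
  using \<open>t \<le> n\<close>
proof (induction t)
  case 0
  then show ?case using good_id by auto
next
  case (Suc t)
  then obtain f where f: "good f" "\<And>j. j < t \<Longrightarrow> f (mat_col n A j) = unit_fun j"
    "\<And>j. j < t \<Longrightarrow> f (mat_col n A (n + j)) = unit_fun (n + j)" by auto
  have t: "t < n" using Suc.prems by simp
  have gram: "int_form n (mat_col n A i) (mat_col n A j) = int_form n (unit_fun i) (unit_fun j)"
    if "i < 2 * n" "j < 2 * n" for i j
    using A that by (simp add: Sp_int_iff_cols)
  \<comment> \<open>Stated for any such \<open>g\<close>: it serves for \<open>f\<close> at column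
    \<open>t\<close> and for \<open>g \<circ> f\<close> at column \<open>n + t\<close>.\<close>
  have supp: "supported t (g (mat_col n A j))"
    if g: "good g" "\<And>j. j < t \<Longrightarrow> g (mat_col n A j) = unit_fun j"
      "\<And>j. j < t \<Longrightarrow> g (mat_col n A (n + j)) = unit_fun (n + j)" and j: "j = t \<or> j = n + t" for g j
  proof -
    let ?z = "g (mat_col n A j)"
    have pres: "int_form n (g u) (g v) = int_form n u v" and out: "2 * n \<le> p \<Longrightarrow> g u p = u p" for u v p
      using g(1) by (auto simp: good_def sp_map_def)
    have "?z i = 0 \<and> ?z (n + i) = 0" if i: "i < t" for i
    proof -
      have "?z (n + i) = int_form n (unit_fun i) (unit_fun j)"
        using int_form_unit(1)[of i n ?z] pres[of "mat_col n A i" "mat_col n A j"] g(2)[OF i] gram[of i j] i t j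
        by auto
      moreover have "- ?z i = int_form n (unit_fun (n + i)) (unit_fun j)"
        using int_form_unit(2)[of i n ?z] pres[of "mat_col n A (n + i)" "mat_col n A j"] g(3)[OF i]
          gram[of "n + i" j] i t j
        by auto
      ultimately show ?thesis
        using i t j int_form_unit[of i n "unit_fun j"] by (auto simp: unit_fun_def)
    qed
    moreover have "?z p = 0" if "2 * n \<le> p" for p using out[OF that] that by (simp add: mat_col_def)
    ultimately show ?thesis
      unfolding supported_def
      by (metis add_diff_inverse_nat linorder_not_less mult_2 nat_add_left_cancel_less)
  qed
  let ?V = "unit_fun ` {..<t} \<union> (\<lambda>j. unit_fun (n + j)) ` {..<t}"
  have V: "vanishing t ?V" by (auto simp: vanishing_def unit_fun_def)
  have pres_f: "int_form n (f u) (f v) = int_form n u v" for u v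
    using f(1) by (auto simp: good_def sp_map_def)
  have "int_form n (f (mat_col n A t)) (f (mat_col n A (n + t))) = 1"
    using pres_f gram[of t "n + t"] t int_form_unit(1)[of t n "unit_fun (n + t)"] by (simp add: unit_fun_def)
  from reach_unit[OF V supp[OF f] this t]
  obtain g where g: "good g" "\<And>v. v \<in> ?V \<Longrightarrow> g v = v" "g (f (mat_col n A t)) = unit_fun t"
    unfolding reach_def by auto
  have gf: "good (g \<circ> f)" using g f good_comp by blast
  have gfV: "(g \<circ> f) (mat_col n A j) = unit_fun j" "(g \<circ> f) (mat_col n A (n + j)) = unit_fun (n + j)"
    if "j < t" for j
    using f(2,3)[OF that] g(2) that by auto
  let ?y = "(g \<circ> f) (mat_col n A (n + t))"
  \<comment> \<open>Pairing with the column just normalised yields the pivot 1 at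
    \<open>n + t\<close>.\<close>
  have "int_form n (unit_fun t) ?y = int_form n ((g \<circ> f) (mat_col n A t)) ?y" using g(3) by simp
  also have "\<dots> = int_form n (mat_col n A t) (mat_col n A (n + t))"
    using gf by (auto simp: good_def sp_map_def)
  also have "\<dots> = 1"
    using gram[of t "n + t"] t int_form_unit(1)[of t n "unit_fun (n + t)"] by (simp add: unit_fun_def)
  finally have "?y (n + t) = 1" using int_form_unit(1)[OF t] by simp
  from reach_dual_unit[OF V supp[OF gf gfV] this t]
  obtain h where h: "good h" "\<And>v. v \<in> insert (unit_fun t) ?V \<Longrightarrow> h v = v" "h ?y = unit_fun (n + t)"
    unfolding reach_def by auto
  have "(h \<circ> (g \<circ> f)) (mat_col n A j) = unit_fun j \<and> (h \<circ> (g \<circ> f)) (mat_col n A (n + j)) = unit_fun (n + j)"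
    if "j < Suc t" for j
  proof (cases "j = t")
    case True
    then show ?thesis using h g(3) by auto
  next
    case False
    then have j: "j < t" using that by simp
    show ?thesis using gfV[OF j] h(2) j by auto
  qed
  then show ?case using good_comp[OF h(1) gf] by blast
qed

text \<open>Reducing all columns of \<open>A\<close> exhibits it as the inverse of an element of
  \<open>G\<close>.\<close>

theorem eq_carrier: "G = carrier (Sp_int n)"
proof
  show "G \<subseteq> carrier (Sp_int n)" using subgroup.subset[OF subgroup] .
  show "carrier (Sp_int n) \<subseteq> G"
  proof
    fix A assume A: "A \<in> carrier (Sp_int n)"
    then have Ac: "A \<in> carrier_mat (2 * n) (2 * n)" by (simp add: Sp_int_def)
    obtain f where f: "good f" "\<And>j. j < n \<Longrightarrow> f (mat_col n A j) = unit_fun j"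
      "\<And>j. j < n \<Longrightarrow> f (mat_col n A (n + j)) = unit_fun (n + j)"
      using reduce_columns[OF A, of n] by auto
    have col: "mat_col n (mat_of n f * A) j = unit_fun j" if "j < 2 * n" for j
    proof (cases "j < n")
      case True
      then show ?thesis using mat_col_mult[OF good_sp_map[OF f(1)] Ac that] f(2) by simp
    next
      case False
      then show ?thesis using mat_col_mult[OF good_sp_map[OF f(1)] Ac that] f(3)[of "j - n"] that by simp
    qed
    have "mat_of n f * A = 1\<^sub>m (2 * n)"
    proof (rule eq_matI)
      fix i j assume "i < dim_row (1\<^sub>m (2 * n) :: int mat)" "j < dim_col (1\<^sub>m (2 * n) :: int mat)"
      then show "(mat_of n f * A) $$ (i, j) = 1\<^sub>m (2 * n) $$ (i, j)"
        using col[of j] by (auto simp: mat_col_def unit_fun_def fun_eq_iff simp del: index_mult_mat(1) split: if_splits)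
    qed (use Ac in \<open>auto simp: mat_of_def\<close>)
    then show "A \<in> G" using left_inverse_mem[OF A] f(1) unfolding good_def by blast
  qed
qed

end

section \<open>Commutator identities\<close>

lemma offset_neq: "i < n \<Longrightarrow> n + j \<noteq> i" "i < n \<Longrightarrow> i \<noteq> n + j" for n :: nat
  by auto

lemma distinct_unfold: "distinct (x # xs) \<longleftrightarrow> (\<forall>y\<in>set xs. x \<noteq> y) \<and> distinct xs"
  by auto

lemmas neq_simps = distinct_unfold distinct.simps(1) list.set ball_simps ball_empty simp_thms

text \<open>The index \<open>a\<close> carries \<open>Y\<close> and \<open>c\<close> carries \<open>Z\<close> because in this position neither interacts with the
  \<open>X\<close>-factors, not even with those of a translate.\<close>

definition addU :: "nat \<Rightarrow> nat \<Rightarrow> nat \<Rightarrow> nat \<Rightarrow> nat \<Rightarrow> int \<Rightarrow> (nat \<Rightarrow> int) \<Rightarrow> nat \<Rightarrow> int" where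
  "addU n a b b' c e = addX n a b e \<circ> addX n b' c e \<circ> addY n a e \<circ> addZ n c e"

text \<open>The four factors read \<open>b\<close>, \<open>n + a\<close>, \<open>c\<close>,
  \<open>n + b'\<close> and write \<open>a\<close>, \<open>n + b\<close>, \<open>b'\<close>,
  \<open>n + c\<close>, which are disjoint. So the map is 1 + e N with N^2 = 0, and negating
  \<open>e\<close> inverts it.\<close>

lemma addU_apply:
  assumes "distinct [a, b, b', c]" "a < n" "b < n" "b' < n" "c < n"
  shows "addU n a b b' c e x p = x p + e * (if p = a then x b + x (n + a) else if p = b' then x c
    else if p = n + b then - x (n + a) else if p = n + c then x c - x (n + b') else 0)"
  using assms by (simp only: neq_simps, elim conjE) (simp add: offset_neq addU_def addX_def addY_def addZ_def algebra_simps)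

lemma sp_map_addU:
  assumes "distinct [a, b, b', c]" "a < n" "b < n" "b' < n" "c < n"
  shows "sp_map n (addU n a b b' c e)"
  unfolding addU_def using assms by (intro sp_map_comp sp_map_addX sp_map_addY sp_map_addZ) auto

lemma addU_inverse:
  assumes "distinct [a, b, b', c]" "a < n" "b < n" "b' < n" "c < n"
  shows "addU n a b b' c e \<circ> addU n a b b' c (- e) = id"
  using assms by (intro ext, simp only: neq_simps, elim conjE) (simp add: offset_neq addU_apply algebra_simps)

lemma addU_commute:
  assumes "distinct [a, b, b', c, A, B, B', C]" "a < n" "b < n" "b' < n" "c < n" "A < n" "B < n" "B' < n" "C < n"
  shows "addU n a b b' c e \<circ> addU n A B B' C d = addU n A B B' C d \<circ> addU n a b b' c e"
  using assms by (intro ext, simp only: neq_simps, elim conjE) (simp add: offset_neq addU_apply)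

text \<open>Only \<open>addX n a b\<close> and \<open>addX n b C\<close> interact, through the
  shared index \<open>b\<close>: this is the Steinberg relation [X_ab, X_bC] = X_aC.\<close>

lemma addU_swap:
  assumes "distinct [a, b, b', c, A, B, C]" "a < n" "b < n" "b' < n" "c < n" "A < n" "B < n" "C < n"
  shows "addU n a b b' c 1 \<circ> addU n A B b C (-1) = addX n a C (-1) \<circ> (addU n A B b C (-1) \<circ> addU n a b b' c 1)"
  using assms by (intro ext, simp only: neq_simps, elim conjE) (simp add: offset_neq addU_apply addX_def)

lemma permP_addU:
  assumes \<pi>: "bij_betw \<pi> {..<n} {..<n}" and "a < n" "b < n" "b' < n" "c < n"
  shows "permP n \<pi> \<circ> addU n (\<pi> a) (\<pi> b) (\<pi> b') (\<pi> c) e = addU n a b b' c e \<circ> permP n \<pi>"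
proof
  fix x
  note c = permP_addX[OF \<pi>, THEN fun_cong, unfolded o_apply] permP_addY[OF \<pi>, THEN fun_cong, unfolded o_apply]
    permP_addZ[OF \<pi>, THEN fun_cong, unfolded o_apply]
  show "(permP n \<pi> \<circ> addU n (\<pi> a) (\<pi> b) (\<pi> b') (\<pi> c) e) x = (addU n a b b' c e \<circ> permP n \<pi>) x"
    using assms by (simp add: addU_def c)
qed

section \<open>Identities that isolate the coordinate transvections\<close>

definition addYY :: "nat \<Rightarrow> nat \<Rightarrow> nat \<Rightarrow> int \<Rightarrow> (nat \<Rightarrow> int) \<Rightarrow> nat \<Rightarrow> int" where
  "addYY n i j c x = x(i := x i + c * x (n + j), j := x j + c * x (n + i))"

text \<open>\<open>addYY\<close> and \<open>addZZ\<close> place c (E_ij + E_ji) in the upper right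
  or lower left block: the off-diagonal companions of \<open>addY\<close> and
  \<open>addZ\<close>.\<close>

definition addZZ :: "nat \<Rightarrow> nat \<Rightarrow> nat \<Rightarrow> int \<Rightarrow> (nat \<Rightarrow> int) \<Rightarrow> nat \<Rightarrow> int" where
  "addZZ n i j c x = x(n + i := x (n + i) + c * x j, n + j := x (n + j) + c * x i)"

lemma sp_map_addYY:
  assumes ij: "i < n" "j < n" "i \<noteq> j"
  shows "sp_map n (addYY n i j c)"
proof -
  have "lin_form (2 * n) (\<lambda>x. addYY n i j c x p)" if "p < 2 * n" for p
    using ij that
    by (cases "p =  i"; cases "p =  j") (auto simp: addYY_def intro!: lin_form_intros)
  moreover have "int_form n (addYY n i j c x) (addYY n i j c y) = int_form n x y" for x y
  proof -
    let ?D = "c * (x (n + j) * y (n + i) - x (n + i) * y (n + j))"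
    have "int_form n (addYY n i j c x) (addYY n i j c y) = (\<Sum>p<n. x p * y (n + p) - x (n + p) * y p
        + (if p = i then ?D else 0) + (if p = j then - ?D else 0))"
      unfolding int_form_def using ij
      by (intro sum.cong refl) (auto simp: addYY_def algebra_simps)
    also have "\<dots> = int_form n x y"
      unfolding int_form_def using ij by (simp only: sum.distrib sum.delta finite_lessThan) simp
    finally show ?thesis .
  qed
  ultimately show ?thesis using ij by (auto simp: sp_map_def addYY_def)
qed

lemma sp_map_addZZ:
  assumes ij: "i < n" "j < n" "i \<noteq> j"
  shows "sp_map n (addZZ n i j c)"
proof -
  have "lin_form (2 * n) (\<lambda>x. addZZ n i j c x p)" if "p < 2 * n" for p
    using ij that
    by (cases "p = n + i"; cases "p = n + j") (auto simp: addZZ_def intro!: lin_form_intros)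
  moreover have "int_form n (addZZ n i j c x) (addZZ n i j c y) = int_form n x y" for x y
  proof -
    let ?D = "c * (x i * y j - x j * y i)"
    have "int_form n (addZZ n i j c x) (addZZ n i j c y) = (\<Sum>p<n. x p * y (n + p) - x (n + p) * y p
        + (if p = i then ?D else 0) + (if p = j then - ?D else 0))"
      unfolding int_form_def using ij
      by (intro sum.cong refl) (auto simp: addZZ_def algebra_simps)
    also have "\<dots> = int_form n x y"
      unfolding int_form_def using ij by (simp only: sum.distrib sum.delta finite_lessThan) simp
    finally show ?thesis .
  qed
  ultimately show ?thesis using ij by (auto simp: sp_map_def addZZ_def)
qed

definition addQ :: "nat \<Rightarrow> nat \<Rightarrow> nat \<Rightarrow> nat \<Rightarrow> nat \<Rightarrow> int \<Rightarrow> (nat \<Rightarrow> int) \<Rightarrow> nat \<Rightarrow> int" where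
  "addQ n a a' c c' e = addY n a e \<circ> addY n a' (- e) \<circ> addZ n c e \<circ> addZ n c' (- e)"

text \<open>All eight factors of the quotient commute, so the \<open>addX\<close> maps on the left
  cancel its \<open>addX\<close> factors and leave the \<open>addY\<close> and \<open>addZ\<close>
  factors.\<close>

lemma addQ_of_addU:
  assumes "distinct [a, b, b', c, A, B, B', C]" "a < n" "b < n" "b' < n" "c < n" "A < n" "B < n" "B' < n" "C < n"
  shows "addX n A B 1 \<circ> addX n B' C 1 \<circ> addX n a b (-1) \<circ> addX n b' c (-1)
    \<circ> (addU n a b b' c 1 \<circ> addU n A B B' C (-1)) = addQ n a A c C 1"
  using assms by (intro ext, simp only: neq_simps, elim conjE) (simp add: offset_neq addU_apply addX_def addY_def addZ_def addQ_def)

lemma addX_commutator: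
  assumes "distinct [i, j, l]" "i < n" "j < n" "l < n"
  shows "addX n i j 1 \<circ> addX n j l 1 \<circ> addX n i j (-1) \<circ> addX n j l (-1) = addX n i l 1"
  using assms by (intro ext, simp only: neq_simps, elim conjE) (simp add: offset_neq addX_def)

text \<open>As \<open>b\<close> is a new index, \<open>addX n b a\<close> meets only the factor
  \<open>addY n a\<close>, and \<open>addX n c b\<close> only \<open>addZ n c\<close>; the rest
  cancels.\<close>

lemma addQ_commutators:
  assumes "distinct [a, a', c, c', b]" "a < n" "a' < n" "c < n" "c' < n" "b < n"
  shows "addX n b a 1 \<circ> addQ n a a' c c' 1 \<circ> addX n b a (-1) \<circ> addQ n a a' c c' (-1)
      = addYY n a b 1 \<circ> addY n b 1"
    and "addX n c b 1 \<circ> addQ n a a' c c' 1 \<circ> addX n c b (-1) \<circ> addQ n a a' c c' (-1)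
      = addZZ n c b (-1) \<circ> addZ n b 1"
  using assms by (intro ext, simp only: neq_simps, elim conjE, simp add: offset_neq addX_def addY_def addZ_def addQ_def addYY_def addZZ_def)+

lemma addQ_inverse:
  assumes "distinct [a, a', c, c']" "a < n" "a' < n" "c < n" "c' < n"
  shows "addQ n a a' c c' 1 \<circ> addQ n a a' c c' (-1) = id"
  using assms by (intro ext, simp only: neq_simps, elim conjE) (simp add: offset_neq addY_def addZ_def addQ_def)

lemma sp_map_addQ:
  "a < n \<Longrightarrow> a' < n \<Longrightarrow> c < n \<Longrightarrow> c' < n \<Longrightarrow> sp_map n (addQ n a a' c c' e)"
  unfolding addQ_def by (intro sp_map_comp sp_map_addY sp_map_addZ)

text \<open>These split off \<open>addY n b\<close>: a commutator with \<open>addX n d a\<close>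
  leaves a pure \<open>addYY\<close> at \<open>d\<close> and \<open>b\<close>, a second one carries
  it back to \<open>a\<close> and \<open>b\<close>, and dividing by it isolates
  \<open>addY n b\<close>.\<close>

lemma addYY_commutators:
  assumes "distinct [a, b, d]" "a < n" "b < n" "d < n"
  shows "addX n d a 1 \<circ> (addYY n a b 1 \<circ> addY n b 1) \<circ> addX n d a (-1) \<circ> (addYY n a b (-1) \<circ> addY n b (-1))
      = addYY n d b 1"
    and "addX n a d 1 \<circ> addYY n d b 1 \<circ> addX n a d (-1) \<circ> addYY n d b (-1) = addYY n a b 1"
    and "addYY n a b e \<circ> addYY n a b (- e) = id"
    and "addYY n a b e \<circ> addY n b e \<circ> (addYY n a b (- e) \<circ> addY n b (- e)) = id"
    and "addYY n a b (-1) \<circ> (addYY n a b 1 \<circ> addY n b 1) = addY n b 1"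
  using assms by (intro ext, simp only: neq_simps, elim conjE, simp add: offset_neq addX_def addY_def addYY_def algebra_simps)+

lemma addZZ_commutators:
  assumes "distinct [c, b, d]" "c < n" "b < n" "d < n"
  shows "addX n c d 1 \<circ> (addZZ n c b (-1) \<circ> addZ n b 1) \<circ> addX n c d (-1) \<circ> (addZZ n c b 1 \<circ> addZ n b (-1))
      = addZZ n d b 1"
    and "addX n d c 1 \<circ> addZZ n d b 1 \<circ> addX n d c (-1) \<circ> addZZ n d b (-1) = addZZ n c b (-1)"
    and "addZZ n c b e \<circ> addZZ n c b (- e) = id"
    and "addZZ n c b (- e) \<circ> addZ n b e \<circ> (addZZ n c b e \<circ> addZ n b (- e)) = id"
    and "addZZ n c b 1 \<circ> (addZZ n c b (-1) \<circ> addZ n b 1) = addZ n b 1"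
  using assms by (intro ext, simp only: neq_simps, elim conjE, simp add: offset_neq addX_def addZ_def addZZ_def algebra_simps)+

section \<open>Subgroups containing a transitive pair of permutations\<close>

context sp_subgroup
begin

lemma good_one_parameter:
  fixes F :: "int \<Rightarrow> (nat \<Rightarrow> int) \<Rightarrow> nat \<Rightarrow> int"
  assumes add: "\<And>c d. F c \<circ> F d = F (c + d)" and zero: "F 0 = id"
    and sp: "\<And>c. sp_map n (F c)" and e: "good (F e)" "e = 1 \<or> e = -1"
  shows "good (F c)"
proof -
  have inv: "good (F (- d))" if "good (F d)" for d
    using good_inverse[OF that sp, of "- d"] by (simp add: add zero)
  have one: "good (F 1)" using e inv[of "-1"] by auto
  have nat: "good (F (int m))" for m
  proof (induction m)
    case 0
    show ?case unfolding of_nat_0 zero by (rule good_id)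
  next
    case (Suc m)
    then show ?case using good_comp[OF one Suc] by (simp add: add)
  qed
  show ?thesis
    by (cases c rule: int_cases2) (use nat inv in auto)
qed

lemma good_addX_multiple:
  "good (addX n i j e) \<Longrightarrow> e = 1 \<or> e = -1 \<Longrightarrow> i < n \<Longrightarrow> j < n \<Longrightarrow> i \<noteq> j \<Longrightarrow> good (addX n i j c)"
  by (rule good_one_parameter[of "addX n i j"]) (auto simp: addX_add sp_map_addX)

lemma good_addY_multiple:
  "good (addY n i e) \<Longrightarrow> e = 1 \<or> e = -1 \<Longrightarrow> i < n \<Longrightarrow> good (addY n i c)"
  by (rule good_one_parameter[of "addY n i"]) (auto simp: addY_add sp_map_addY)

lemma good_addZ_multiple:
  "good (addZ n i e) \<Longrightarrow> e = 1 \<or> e = -1 \<Longrightarrow> i < n \<Longrightarrow> good (addZ n i c)"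
  by (rule good_one_parameter[of "addZ n i"]) (auto simp: addZ_add sp_map_addZ)

lemma good_intertwine:
  assumes f: "good f" and f': "sp_map n f'" "f \<circ> f' = id" "f' \<circ> f = id" and fg: "f \<circ> g = h \<circ> f"
  shows "good g \<longleftrightarrow> good h"
proof -
  have gf': "good f'" using good_inverse[OF f f'(1,2)] .
  have "f \<circ> g \<circ> f' = h \<circ> (f \<circ> f')" using fg by (simp add: o_assoc)
  then have h: "h = f \<circ> g \<circ> f'" using f' by simp
  have "f' \<circ> h \<circ> f = (f' \<circ> f) \<circ> g" using fg by (simp add: o_assoc[symmetric])
  then have g: "g = f' \<circ> h \<circ> f" using f' by simp
  show ?thesis using good_comp f gf' h g by metis
qed

lemma good_intertwine_perm:
  assumes "bij_betw \<pi> {..<n} {..<n}" "good (permP n \<pi>)" "permP n \<pi> \<circ> g = h \<circ> permP n \<pi>"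
  shows "good g \<longleftrightarrow> good h"
  using permP_inverse[OF assms(1)] good_intertwine[OF assms(2) _ _ _ assms(3)] by metis

lemma good_addX_trans:
  assumes "good (addX n i j 1)" "good (addX n j l 1)" "distinct [i, j, l]" "i < n" "j < n" "l < n"
  shows "good (addX n i l 1)"
  using good_commutator[OF assms(1,2), of "addX n i j (-1)" "addX n j l (-1)"] addX_commutator[OF assms(3-6)] assms
  by (simp add: sp_map_addX addX_add)

end

text \<open>Transitivity enters as \<open>link\<close>: neighbouring indices are joined by one of
  the permutations, so spreading is an induction along the indices.\<close>

locale sp_perm_subgroup = sp_subgroup +
  fixes \<sigma> \<tau> :: "nat \<Rightarrow> nat"
  assumes bij_\<sigma>: "bij_betw \<sigma> {..<n} {..<n}" and bij_\<tau>: "bij_betw \<tau> {..<n} {..<n}"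
    and good_\<sigma>: "good (permP n \<sigma>)" and good_\<tau>: "good (permP n \<tau>)"
    and link: "Suc i < n \<Longrightarrow> \<sigma> i = Suc i \<or> \<tau> i = Suc i"
begin

definition linked :: "nat \<Rightarrow> nat \<Rightarrow> bool" where
  "linked i j \<longleftrightarrow> i < n \<and> j < n \<and> (i = j \<or> good (addX n i j 1))"

lemma linked_perm:
  assumes "i < n" "j < n"
  shows "linked (\<sigma> i) (\<sigma> j) \<longleftrightarrow> linked i j" "linked (\<tau> i) (\<tau> j) \<longleftrightarrow> linked i j"
  using good_intertwine_perm[OF bij_\<sigma> good_\<sigma> permP_addX[OF bij_\<sigma> assms]] permD[OF bij_\<sigma>]
    good_intertwine_perm[OF bij_\<tau> good_\<tau> permP_addX[OF bij_\<tau> assms]] permD[OF bij_\<tau>] assms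
  by (simp_all add: linked_def)

lemma linked_trans: "linked i j \<Longrightarrow> linked j l \<Longrightarrow> linked i l"
  using good_addX_trans[of i j l] by (auto simp: linked_def)

lemma adjacent_induct:
  assumes "P (i :: nat)" "i < n" "j < n"
    and "\<And>i. Suc i < n \<Longrightarrow> P i \<longleftrightarrow> P (Suc i)"
  shows "P j"
proof -
  have "P m \<longleftrightarrow> P 0" if "m < n" for m
    using that assms(4) by (induction m) auto
  then show ?thesis using assms by blast
qed

text \<open>\<sigma> and \<tau> map the set reachable from a point bijectively onto that of its
  image, and \<open>link\<close> then connects all points.\<close>

lemma card_linked:
  assumes "i < n" "j < n"
  shows "card {l. linked i l} = card {l. linked j l}"
proof -
  have perm: "card {l. linked (\<pi> i) l} = card {l. linked i l}"
    if \<pi>: "bij_betw \<pi> {..<n} {..<n}" and inv: "\<And>i j. i < n \<Longrightarrow> j < n \<Longrightarrow> linked (\<pi> i) (\<pi> j) \<longleftrightarrow> linked i j"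
      and i: "i < n" for \<pi> i
  proof -
    have "{l. linked (\<pi> i) l} = \<pi> ` {l. linked i l}"
    proof (intro equalityI subsetI)
      fix l assume "l \<in> {l. linked (\<pi> i) l}"
      then have l: "linked (\<pi> i) l" "l < n" by (auto simp: linked_def)
      then obtain m where "m < n" "l = \<pi> m" using \<pi> by (metis bij_betw_imp_surj_on imageE lessThan_iff)
      then show "l \<in> \<pi> ` {l. linked i l}" using l inv[OF i] by auto
    next
      fix l assume "l \<in> \<pi> ` {l. linked i l}"
      then obtain m where "l = \<pi> m" "linked i m" by auto
      moreover then have "m < n" by (simp add: linked_def)
      ultimately show "l \<in> {l. linked (\<pi> i) l}" using inv[OF i] by auto
    qed
    moreover have "inj_on \<pi> {l. linked i l}"
      using bij_betw_imp_inj_on[OF \<pi>] by (rule inj_on_subset) (auto simp: linked_def)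
    ultimately show ?thesis by (simp add: card_image)
  qed
  show ?thesis
  proof (rule adjacent_induct[where P = "\<lambda>m. card {l. linked i l} = card {l. linked m l}" and i = i])
    fix m assume m: "Suc m < n"
    have "card {l. linked (Suc m) l} = card {l. linked m l}"
      using link[OF m] perm[OF bij_\<sigma> linked_perm(1), of m] perm[OF bij_\<tau> linked_perm(2), of m] m by auto
    then show "card {l. linked i l} = card {l. linked m l} \<longleftrightarrow> card {l. linked i l} = card {l. linked (Suc m) l}"
      by simp
  qed (use assms in auto)
qed

text \<open>The sets of points reachable from \<open>i\<close> and from \<open>j\<close> have the same finite size, so the inclusion
  given by transitivity is an equality.\<close>

lemma linked_sym:
  assumes ij: "linked i j"
  shows "linked j i"
proof -
  have lt: "i < n" "j < n" using ij by (auto simp: linked_def)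
  have "{l. linked j l} \<subseteq> {l. linked i l}" using linked_trans[OF ij] by auto
  moreover have "finite {l. linked i l}" by (rule finite_subset[of _ "{..<n}"]) (auto simp: linked_def)
  ultimately have "{l. linked j l} = {l. linked i l}" using card_linked[OF lt] by (metis card_subset_eq)
  moreover have "linked i i" using lt by (simp add: linked_def)
  ultimately show ?thesis by auto
qed

text \<open>By \<open>linked_sym\<close> the relation is an equivalence, invariant under \<sigma>
  and \<tau>. If the class of 0 contains both images of 0, both permutations preserve it, so by
  \<open>link\<close> it is everything.\<close>

lemma good_addX_all:
  assumes n: "0 < n" and "linked 0 (\<sigma> 0)" "linked 0 (\<tau> 0)" and ij: "i < n" "j < n" "i \<noteq> j"
  shows "good (addX n i j c)"
proof -
  have iff: "linked 0 (\<sigma> i) \<longleftrightarrow> linked 0 i" "linked 0 (\<tau> i) \<longleftrightarrow> linked 0 i" if "i < n" for i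
    using linked_perm[OF n that] assms(2,3) linked_trans linked_sym by blast+
  have 0: "linked 0 l" if "l < n" for l
  proof (rule adjacent_induct[where P = "linked 0" and i = 0])
    fix m assume m: "Suc m < n"
    show "linked 0 m \<longleftrightarrow> linked 0 (Suc m)" using link[OF m] iff[of m] m by auto
  qed (use that n in \<open>auto simp: linked_def\<close>)
  have "linked i j" using linked_trans[OF linked_sym[OF 0] 0] ij by blast
  then show ?thesis using good_addX_multiple[of i j 1 c] ij by (simp add: linked_def)
qed

lemma good_addYZ_all:
  assumes "i < n" "j < n"
  shows "good (addY n i 1) \<Longrightarrow> good (addY n j c)" "good (addZ n i 1) \<Longrightarrow> good (addZ n j c)"
proof -
  have *: "good (addY n m 1) \<longleftrightarrow> good (addY n (Suc m) 1)" "good (addZ n m 1) \<longleftrightarrow> good (addZ n (Suc m) 1)"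
    if m: "Suc m < n" for m
    using link[OF m] m
      good_intertwine_perm[OF bij_\<sigma> good_\<sigma> permP_addY[OF bij_\<sigma>], of m]
      good_intertwine_perm[OF bij_\<tau> good_\<tau> permP_addY[OF bij_\<tau>], of m]
      good_intertwine_perm[OF bij_\<sigma> good_\<sigma> permP_addZ[OF bij_\<sigma>], of m]
      good_intertwine_perm[OF bij_\<tau> good_\<tau> permP_addZ[OF bij_\<tau>], of m]
    by auto
  show "good (addY n i 1) \<Longrightarrow> good (addY n j c)"
    using adjacent_induct[of "\<lambda>j. good (addY n j 1)" i j] *(1) assms good_addY_multiple[of j 1 c] by auto
  show "good (addZ n i 1) \<Longrightarrow> good (addZ n j c)"
    using adjacent_induct[of "\<lambda>j. good (addZ n j 1)" i j] *(2) assms good_addZ_multiple[of j 1 c] by auto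
qed

end

lemma (in sp_subgroup) good_addYZ_of_addQ:
  assumes X: "\<And>i j c. i < n \<Longrightarrow> j < n \<Longrightarrow> i \<noteq> j \<Longrightarrow> good (addX n i j c)"
    and Q: "good (addQ n a a' c c' 1)"
    and d: "distinct [a, a', c, c', b, d]" "a < n" "a' < n" "c < n" "c' < n" "b < n" "d < n"
  shows "good (addY n b 1)" "good (addZ n b 1)"
proof -
  have d1: "distinct [a, a', c, c', b]" "distinct [a, a', c, c']" "distinct [a, b, d]" "distinct [c, b, d]"
    using d(1) by auto
  have X1: "good (addX n i j 1)" "sp_map n (addX n i j (-1))" "addX n i j 1 \<circ> addX n i j (-1) = id"
    if "i < n" "j < n" "i \<noteq> j" for i j
    using that X by (simp_all add: sp_map_addX addX_add)
  note Q' = sp_map_addQ[OF d(2-5), of "-1"] addQ_inverse[OF d1(2) d(2-5)]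
  note Qc = addQ_commutators[OF d1(1) d(2-6)]
  note YY = addYY_commutators[OF d1(3) d(2,6,7)]
  note ZZ = addZZ_commutators[OF d1(4) d(4,6,7)]
  have 1: "good (addYY n a b 1 \<circ> addY n b 1)"
    using good_commutator[OF X1(1)[of b a] Q X1(2) Q'(1) X1(3) Q'(2)] d Qc(1) by auto
  have 2: "good (addYY n d b 1)"
    using good_commutator[OF X1(1)[of d a] 1 X1(2) _ X1(3) YY(4)] d YY(1) by (auto intro: sp_map_comp sp_map_addYY sp_map_addY)
  have 3: "good (addYY n a b 1)"
    using good_commutator[OF X1(1)[of a d] 2 X1(2) sp_map_addYY X1(3) addYY_commutators(3)[of d b a]] d YY(2) by auto
  have "good (addYY n a b (-1))"
    using good_inverse[OF 3 sp_map_addYY YY(3)] d by auto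
  from good_comp[OF this 1] show "good (addY n b 1)" using YY(5) by simp
  have 1: "good (addZZ n c b (-1) \<circ> addZ n b 1)"
    using good_commutator[OF X1(1)[of c b] Q X1(2) Q'(1) X1(3) Q'(2)] d Qc(2) by auto
  have 2: "good (addZZ n d b 1)"
    using good_commutator[OF X1(1)[of c d] 1 X1(2) _ X1(3) ZZ(4)] d ZZ(1) by (auto intro: sp_map_comp sp_map_addZZ sp_map_addZ)
  have 3: "good (addZZ n c b (-1))"
    using good_commutator[OF X1(1)[of d c] 2 X1(2) sp_map_addZZ X1(3) addZZ_commutators(3)[of d b c]] d ZZ(2) by auto
  have "good (addZZ n c b 1)"
    using good_inverse[OF 3 sp_map_addZZ ZZ(3)[of "-1"]] d by auto
  from good_comp[OF this 1] show "good (addZ n b 1)" using ZZ(5) by simp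
qed

section \<open>Block cycles and orders\<close>

lemma mat_of_inj:
  assumes f: "sp_map n f" and g: "sp_map n g" and eq: "mat_of n f = mat_of n g"
  shows "f = g"
proof (intro ext)
  fix x p
  have "f (unit_fun j) = g (unit_fun j)" if "j < 2 * n" for j
    using mat_col_mat_of[OF f that] mat_col_mat_of[OF g that] eq by simp
  then have "(\<Sum>j<2*n. f (unit_fun j) p * x j) = (\<Sum>j<2*n. g (unit_fun j) p * x j)" by simp
  then show "f x p = g x p"
    using sp_map_linear[OF f, of p x] sp_map_linear[OF g, of p x] f g
    by (cases "p < 2 * n") (auto simp: sp_map_def)
qed

lemma sp_map_funpow: "sp_map n f \<Longrightarrow> sp_map n (f ^^ m)"
  by (induction m) (simp_all only: funpow.simps sp_map_id sp_map_comp)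

lemma ord_mat_of:
  assumes f: "sp_map n f" and k: "\<And>m. f ^^ m = id \<longleftrightarrow> k dvd m"
  shows "group.ord (Sp_int n) (mat_of n f) = k"
proof -
  interpret group "Sp_int n" by (rule group_Sp_int)
  have "mat_of n f [^]\<^bsub>Sp_int n\<^esub> m = mat_of n (f ^^ m)" for m
  proof (induction m)
    case 0
    then show ?case by (simp only: nat_pow_0 funpow.simps mat_of_id) (simp add: Sp_int_def)
  next
    case (Suc m)
    have "mat_of n (f ^^ Suc m) = mat_of n (f ^^ m) * mat_of n f"
      by (simp only: funpow_Suc_right mat_of_comp[OF sp_map_funpow[OF f]])
    moreover have "A \<otimes>\<^bsub>Sp_int n\<^esub> B = A * B" for A B by (simp add: Sp_int_def)
    ultimately show ?case by (simp only: nat_pow_Suc Suc.IH)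
  qed
  then have "mat_of n f [^]\<^bsub>Sp_int n\<^esub> m = \<one>\<^bsub>Sp_int n\<^esub> \<longleftrightarrow> k dvd m" for m
    using mat_of_inj[OF sp_map_funpow[OF f] sp_map_id, of m] k[of m] mat_of_id[of n]
    by (auto simp: Sp_int_def)
  then show ?thesis using ord_unique[OF mat_of_Sp[OF f], of k] by simp
qed

lemma funpow_conj_eq_id:
  assumes "u' \<circ> u = id" "u \<circ> u' = id"
  shows "(u \<circ> f \<circ> u') ^^ m = id \<longleftrightarrow> f ^^ m = id"
proof -
  note inv = pointfree_idE[OF assms(1)] pointfree_idE[OF assms(2)]
  have "((u \<circ> f \<circ> u') ^^ m) x = u ((f ^^ m) (u' x))" for x
    by (induction m) (simp_all add: inv)
  moreover have "(\<forall>x. u ((f ^^ m) (u' x)) = x) \<longleftrightarrow> (\<forall>x. (f ^^ m) x = x)"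
    using inv by metis
  ultimately show ?thesis by (simp add: fun_eq_iff)
qed

section \<open>Products of cycles on consecutive blocks\<close>

definition block_cycle :: "nat \<Rightarrow> nat \<Rightarrow> nat \<Rightarrow> nat \<Rightarrow> nat" where
  "block_cycle s k q i =
    (if s \<le> i \<and> i < s + q * k then s + ((i - s) div k) * k + (i - s + 1) mod k else i)"

lemma block_bound: "m < q * k \<Longrightarrow> (m div k) * k + l mod k < q * k" for m k q l :: nat
proof -
  assume m: "m < q * k"
  then have k: "0 < k" by (cases k) auto
  have "m div k < q" using m by (simp add: less_mult_imp_div_less)
  then have "(m div k + 1) * k \<le> q * k" by (intro mult_right_mono) auto
  then show ?thesis using mod_less_divisor[OF k, of l] by (simp add: algebra_simps)
qed

text \<open>Iteration keeps the block number and advances the residue mod \<open>k\<close>, so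
  period and inverse can be read off.\<close>

lemma block_cycle_funpow:
  "(block_cycle s k q ^^ m) i =
    (if s \<le> i \<and> i < s + q * k then s + ((i - s) div k) * k + (i - s + m) mod k else i)"
proof (induction m)
  case 0
  then show ?case by simp
next
  case (Suc m)
  show ?case
  proof (cases "s \<le> i \<and> i < s + q * k")
    case True
    then have k: "0 < k" by (cases k) auto
    let ?d = "(i - s) div k"
    let ?y = "?d * k + (i - s + m) mod k"
    have y: "?y < q * k" using True by (intro block_bound) auto
    have "?y div k = ?d" using k by simp
    moreover have "(?y + 1) mod k = (i - s + Suc m) mod k"
      by (simp add: mod_Suc_eq)
    ultimately have "block_cycle s k q (s + ?y) = s + ?d * k + (i - s + Suc m) mod k"
      using y by (simp add: block_cycle_def)
    then show ?thesis using Suc True by (simp add: add.assoc)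
  next
    case False
    then show ?thesis using Suc by (auto simp: block_cycle_def)
  qed
qed

lemma block_cycle_funpow_period: "k dvd m \<Longrightarrow> (block_cycle s k q ^^ m) i = i"
proof -
  assume "k dvd m"
  then have "(i - s + m) mod k = (i - s) mod k"
    by (metis mod_add_right_eq dvd_imp_mod_0 add_0_right)
  then show ?thesis by (simp only: block_cycle_funpow add.assoc div_mult_mod_eq) auto
qed

lemma block_cycle_lt: "s + q * k \<le> n \<Longrightarrow> i < n \<Longrightarrow> (block_cycle s k q ^^ m) i < n"
proof -
  assume n: "s + q * k \<le> n" "i < n"
  have "s + ((i - s) div k) * k + l mod k < n" if "i - s < q * k" for l
    using block_bound[OF that, of l] n by linarith
  then show ?thesis using n by (simp add: block_cycle_funpow less_diff_conv2)
qed

lemma bij_block_cycle: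
  assumes n: "s + q * k \<le> n" and k: "0 < k"
  shows "bij_betw (block_cycle s k q) {..<n} {..<n}"
\<comment> \<open>The inverse of a product of \<open>k\<close>-cycles is its power with exponent
  \<open>k - 1\<close>.\<close>
proof (rule bij_betw_byWitness[where f' = "block_cycle s k q ^^ (k - 1)"])
  have e: "(block_cycle s k q ^^ (k - 1 + 1)) i = i" for i
    using k by (intro block_cycle_funpow_period) simp
  show "\<forall>i\<in>{..<n}. (block_cycle s k q ^^ (k - 1)) (block_cycle s k q i) = i"
    using e unfolding funpow_add by simp
  have "(block_cycle s k q ^^ (1 + (k - 1))) i = i" for i using e[of i] by (simp only: add.commute)
  then show "\<forall>i\<in>{..<n}. block_cycle s k q ((block_cycle s k q ^^ (k - 1)) i) = i"
    unfolding funpow_add by simp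
  show "block_cycle s k q ` {..<n} \<subseteq> {..<n}"
    using block_cycle_lt[OF n, of _ 1] by auto
  show "(block_cycle s k q ^^ (k - 1)) ` {..<n} \<subseteq> {..<n}"
    using block_cycle_lt[OF n] by auto
qed

lemma block_cycle_Suc:
  assumes "s \<le> i" "Suc i < s + q * k" "\<not> k dvd (Suc i - s)"
  shows "block_cycle s k q i = Suc i"
proof -
  have "Suc (i - s) mod k = Suc ((i - s) mod k)"
    using assms by (auto simp: mod_Suc Suc_diff_le dvd_eq_mod_eq_0)
  then show ?thesis using assms by (simp add: block_cycle_def)
qed

lemma permP_funpow:
  assumes \<pi>: "bij_betw \<pi> {..<n} {..<n}"
  shows "permP n \<pi> ^^ m = permP n (\<pi> ^^ m)"
proof (induction m)
  case 0
  show ?case by (simp add: permP_id)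
next
  case (Suc m)
  then show ?case by (simp only: funpow.simps(2) permP_comp[OF \<pi>] funpow_Suc_right[symmetric])
qed

lemma permP_block_cycle_period:
  assumes n: "s + q * k \<le> n" and k: "0 < k" and q: "0 < q"
  shows "permP n (block_cycle s k q) ^^ m = id \<longleftrightarrow> k dvd m"
  unfolding permP_funpow[OF bij_block_cycle[OF n k]]
proof
  assume "k dvd m"
  then show "permP n (block_cycle s k q ^^ m) = id"
    by (intro permP_id) (simp add: block_cycle_funpow_period)
next
  assume id: "permP n (block_cycle s k q ^^ m) = id"
  have "0 < q * k" using q k by simp
  then have s: "s < n" "(block_cycle s k q ^^ m) s = s + m mod k"
    using n by (linarith, simp add: block_cycle_funpow)
  \<comment> \<open>Coordinate \<open>s\<close> of the image of \<open>unit_fun s\<close> is 1 only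
    if the iterate returns \<open>s\<close> to itself.\<close>
  have "permP n (block_cycle s k q ^^ m) (unit_fun s) s = 1" using id by (simp add: unit_fun_def)
  then have "m mod k = 0" using s by (simp add: permP_def unit_fun_def split: if_splits)
  then show "k dvd m" by auto
qed

section \<open>The three generators\<close>

text \<open>The blocks containing \<open>0\<close>, \<open>k\<close> and \<open>2 k\<close> carry the factors: \<open>ladder n k (i + 1)\<close> is the translate of
  \<open>ladder n k i\<close> by \<open>\<sigma>\<close>. For \<open>i \<le> 2\<close> the only index written by one of them and read by another is
  \<open>2 k + 2\<close>, shared by \<open>i = 0\<close> and \<open>i = 2\<close>; hence these two fail to commute by a single elementary map.
  No index wraps around its block, as \<open>k \<ge> 5\<close>.\<close>

definition ladder :: "nat \<Rightarrow> nat \<Rightarrow> nat \<Rightarrow> int \<Rightarrow> (nat \<Rightarrow> int) \<Rightarrow> nat \<Rightarrow> int" where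
  "ladder n k i = addU n i (2 * k + i) (2 * k + i + 2) (k + 2 + i)"

lemma ladder_values:
  "ladder n k 0 = addU n 0 (2 * k) (2 * k + 2) (k + 2)"
  "ladder n k 1 = addU n 1 (2 * k + 1) (2 * k + 3) (k + 3)"
  "ladder n k 2 = addU n 2 (2 * k + 2) (2 * k + 4) (k + 4)"
  by (simp_all add: ladder_def eval_nat_numeral)

lemma ladder_props:
  assumes k: "5 \<le> k" "3 * k \<le> n" and i: "i \<le> 2"
  shows "sp_map n (ladder n k i e)" and "ladder n k i e \<circ> ladder n k i (- e) = id"
    and "ladder n k i (- e) \<circ> ladder n k i e = id"
  using addU_inverse[of i "2 * k + i" "2 * k + i + 2" "k + 2 + i" n e]
    addU_inverse[of i "2 * k + i" "2 * k + i + 2" "k + 2 + i" n "- e"] k i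
  by (auto simp: ladder_def intro!: sp_map_addU)

lemma ladder_commute:
  assumes k: "5 \<le> k" "3 * k \<le> n" and i: "i \<le> 1"
  shows "ladder n k (Suc i) c \<circ> ladder n k i d = ladder n k i d \<circ> ladder n k (Suc i) c"
  unfolding ladder_def using k i by (intro addU_commute) auto

lemma permP_ladder:
  assumes k: "5 \<le> k" "3 * k \<le> n" and q: "3 \<le> q" "q * k \<le> n" and i: "i \<le> 1"
  shows "permP n (block_cycle 0 k q) \<circ> ladder n k (Suc i) e = ladder n k i e \<circ> permP n (block_cycle 0 k q)"
proof -
  have shift: "block_cycle 0 k q x = Suc x" if "Suc x < 3 * k" "\<not> k dvd Suc x" for x
  proof (rule block_cycle_Suc)
    have "3 * k \<le> q * k" using q(1) by (rule mult_right_mono) simp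
    then show "Suc x < 0 + q * k" using that(1) by linarith
  qed (use that in auto)
  have "\<not> k dvd Suc i" "\<not> k dvd Suc (2 * k + i)" "\<not> k dvd Suc (2 * k + i + 2)" "\<not> k dvd Suc (k + 2 + i)"
    using k i by (auto simp: dvd_eq_mod_eq_0 mod_Suc le_Suc_eq)
  then have "block_cycle 0 k q i = Suc i" "block_cycle 0 k q (2 * k + i) = 2 * k + Suc i"
    "block_cycle 0 k q (2 * k + i + 2) = 2 * k + Suc i + 2" "block_cycle 0 k q (k + 2 + i) = k + 2 + Suc i"
    using shift[of i] shift[of "2 * k + i"] shift[of "2 * k + i + 2"] shift[of "k + 2 + i"] k i by simp_all
  moreover have "bij_betw (block_cycle 0 k q) {..<n} {..<n}" using k q by (intro bij_block_cycle) auto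
  ultimately show ?thesis
    using permP_addU[of "block_cycle 0 k q" n i "2 * k + i" "2 * k + i + 2" "k + 2 + i" e] k i
    by (simp add: ladder_def)
qed

text \<open>A conjugate of \<sigma>, hence of the same order. The value \<open>e = 1\<close> gives
  \<rho>; other values supply further elements of order \<open>k\<close>.\<close>

definition rung :: "nat \<Rightarrow> nat \<Rightarrow> nat \<Rightarrow> int \<Rightarrow> (nat \<Rightarrow> int) \<Rightarrow> nat \<Rightarrow> int" where
  "rung n k q e = ladder n k 1 e \<circ> permP n (block_cycle 0 k q) \<circ> ladder n k 1 (- e)"

text \<open>As \<open>0 < s\<close> and \<open>s < k\<close>, the blocks of \<tau> straddle those of
  \<sigma>. If \<open>k\<close> does not divide \<open>n\<close>, they end exactly at
  \<open>n\<close> and cover the points left over by \<sigma>; otherwise \<sigma> covers everything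
  and \<tau> has one block fewer.\<close>

locale block_setup =
  fixes n k q s q' :: nat
  assumes k: "5 \<le> k" and n: "3 * k \<le> n"
    and q: "q = n div k" and s: "s = (if n mod k = 0 then 1 else n mod k)"
    and q': "q' = (if n mod k = 0 then q - 1 else q)"
begin

abbreviation "\<sigma> \<equiv> block_cycle 0 k q"
abbreviation "\<tau> \<equiv> block_cycle s k q'"

lemma n_eq: "n = q * k + n mod k"
  by (simp add: q)

lemma q_ge: "3 \<le> q"
  using div_le_mono[OF n, of k] k by (simp add: q)

lemma q'_ge: "2 \<le> q'"
  using q_ge by (auto simp: q')

lemma s_bounds: "0 < s" "s < k"
  using k by (auto simp: s)

lemma fits: "q * k \<le> n" "s + q' * k \<le> n"
proof -
  show "q * k \<le> n" using n_eq by linarith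
  show "s + q' * k \<le> n"
  proof (cases "n mod k = 0")
    case True
    have "(q - 1) * k + k = q * k" using q_ge by (cases q) auto
    then show ?thesis using True n_eq k by (simp add: s q')
  next
    case False
    then show ?thesis using n_eq by (simp add: s q')
  qed
qed

lemma bij: "bij_betw \<sigma> {..<n} {..<n}" "bij_betw \<tau> {..<n} {..<n}"
  using bij_block_cycle[of 0 q k n] bij_block_cycle[of s q' k n] fits k by auto

text \<open>Block boundaries of \<sigma> and \<tau> differ by \<open>s\<close> mod \<open>k\<close>,
  so \<tau> takes over at the boundaries of \<sigma>, and also beyond its last block.\<close>

lemma link: "Suc i < n \<Longrightarrow> \<sigma> i = Suc i \<or> \<tau> i = Suc i"
proof -
  assume i: "Suc i < n"
  show ?thesis
  proof (cases "k dvd Suc i")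
    case True
    then have "k \<le> Suc i" by (auto dest: dvd_imp_le)
    then have si: "s \<le> i" using s_bounds by simp
    have "\<not> k dvd (Suc i - s)"
    proof
      assume "k dvd Suc i - s"
      then have "k dvd s" using True si by (metis dvd_diff_nat diff_diff_cancel le_SucI)
      then show False using s_bounds by (auto dest: dvd_imp_le)
    qed
    moreover have "Suc i < s + q' * k"
    proof (cases "n mod k = 0")
      case n0: True
      obtain l where l: "Suc i = l * k" using True by (metis dvdE mult.commute)
      have "l * k < q * k" using i n_eq n0 l by simp
      then have "l \<le> q - 1" by auto
      then have "l * k \<le> (q - 1) * k" by (rule mult_right_mono) simp
      then have "Suc i < 1 + (q - 1) * k" using l by linarith
      then show ?thesis using n0 by (simp add: s q')
    next
      case False
      then show ?thesis using i n_eq by (simp add: s q')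
    qed
    ultimately show ?thesis using block_cycle_Suc si by blast
  next
    case False
    show ?thesis
    proof (cases "Suc i < q * k")
      case True
      then show ?thesis using block_cycle_Suc[of 0 i q k] False by simp
    next
      \<comment> \<open>Here \<open>i\<close> is in the last block of \<tau>. If
        \<open>Suc i\<close> were a boundary of \<tau> below \<open>n\<close>, it would be at most
        \<open>k * q - k + s\<close>, which is less than \<open>q * k\<close>.\<close>
      case ge: False
      have r: "n mod k \<noteq> 0" using ge i n_eq by auto
      have sq: "s = n mod k" "q' = q" using r by (simp_all add: s q')
      have "s < q * k" using s_bounds mult_right_mono[OF q_ge, of k] by linarith
      then have si: "s \<le> i" using ge by linarith
      have "\<not> k dvd (Suc i - s)"
      proof
        assume "k dvd Suc i - s"
        then obtain l where l: "Suc i - s = k * l" by blast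
        have "k * l < q * k" using l i n_eq si sq(1) by linarith
        then have "k * l < k * q" by (simp add: mult.commute)
        then have "l \<le> q - 1" by auto
        then have "k * l \<le> k * (q - 1)" by simp
        also have "\<dots> = k * q - k" by (simp add: diff_mult_distrib2)
        finally have "Suc i \<le> k * q - k + s" using l si by linarith
        moreover have "k \<le> k * q" using q_ge by simp
        ultimately show False using ge s_bounds by (simp add: mult.commute)
      qed
      then show ?thesis using block_cycle_Suc[of s i q' k] si i n_eq sq by simp
    qed
  qed
qed

text \<open>These values carry the index pair (2, k + 2) back to (0, k) along \<sigma> and then by
  \<tau> to (0, \<open>\<tau> k\<close>).\<close>

lemma cycle_values: "\<sigma> 0 = 1" "\<sigma> 1 = 2" "\<sigma> k = k + 1" "\<sigma> (k + 1) = k + 2" "\<tau> 0 = 0"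
  "s = 1 \<Longrightarrow> \<tau> k = 1" "s \<noteq> 1 \<Longrightarrow> \<tau> k = k + 1"
proof -
  have big: "3 * k \<le> q * k" "2 * k \<le> q' * k" using q_ge q'_ge by (auto intro: mult_right_mono)
  have nd: "\<not> k dvd Suc 0" "\<not> k dvd Suc 1" "\<not> k dvd Suc k" "\<not> k dvd Suc (k + 1)"
    using k by (auto simp: dvd_eq_mod_eq_0 mod_Suc)
  show "\<sigma> 0 = 1" "\<sigma> 1 = 2" "\<sigma> k = k + 1" "\<sigma> (k + 1) = k + 2"
    using block_cycle_Suc[of 0 0 q k] block_cycle_Suc[of 0 1 q k] block_cycle_Suc[of 0 k q k]
      block_cycle_Suc[of 0 "k + 1" q k] nd big k by auto
  show "\<tau> 0 = 0" using s_bounds by (simp add: block_cycle_def)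
  \<comment> \<open>For \<open>s = 1\<close> the first block of \<tau> is 1, ..., \<open>k\<close>,
    so \<open>k\<close> wraps around; for larger \<open>s\<close> it has a successor inside the
    block.\<close>
  show "\<tau> k = 1" if "s = 1"
  proof -
    have "k < 1 + q' * k" using big(2) k by linarith
    then show ?thesis using that k by (simp add: block_cycle_def)
  qed
  show "\<tau> k = k + 1" if "s \<noteq> 1"
  proof -
    have "\<not> k dvd (Suc k - s)" using s_bounds that by (auto dest!: dvd_imp_le)
    then show ?thesis using block_cycle_Suc[of s k q' k] s_bounds big k by simp
  qed
qed

lemma sp_map_perms: "sp_map n (permP n \<sigma>)" "sp_map n (permP n \<tau>)"
  using bij by (auto intro: sp_map_permP)

lemma sp_map_rung: "sp_map n (rung n k q e)"
  unfolding rung_def using k n by (intro sp_map_comp sp_map_perms ladder_props(1)) auto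

lemma ord_perms:
  "group.ord (Sp_int n) (mat_of n (permP n \<sigma>)) = k" "group.ord (Sp_int n) (mat_of n (permP n \<tau>)) = k"
  using permP_block_cycle_period[of 0 q k n] permP_block_cycle_period[of s q' k n] fits k q_ge q'_ge
  by (intro ord_mat_of sp_map_perms; simp)+

lemma ord_rung: "group.ord (Sp_int n) (mat_of n (rung n k q e)) = k"
proof (rule ord_mat_of[OF sp_map_rung])
  fix m
  have "rung n k q e ^^ m = id \<longleftrightarrow> permP n \<sigma> ^^ m = id"
    unfolding rung_def using k n by (intro funpow_conj_eq_id ladder_props) auto
  also have "\<dots> \<longleftrightarrow> k dvd m" using fits k q_ge by (intro permP_block_cycle_period) auto
  finally show "rung n k q e ^^ m = id \<longleftrightarrow> k dvd m" .
qed

lemma rung_eq: "rung n k q e = ladder n k 1 e \<circ> ladder n k 0 (- e) \<circ> permP n \<sigma>"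
  unfolding rung_def using permP_ladder[OF k n q_ge fits(1), of 0 "- e"] by (simp only: o_assoc[symmetric]) simp

lemma rung_inj:
  assumes "rung n k q e = rung n k q e'"
  shows "e = e'"
proof -
  obtain f where f: "permP n \<sigma> \<circ> f = id" using permP_inverse[OF bij(1)] by blast
  have "rung n k q c \<circ> f = ladder n k 1 c \<circ> ladder n k 0 (- c)" for c
    unfolding rung_eq using f by (simp only: o_assoc[symmetric] comp_id)
  \<comment> \<open>This reads the entry in row 1 and column \<open>2 * k + 1\<close>:
    \<open>ladder n k 0\<close> fixes that unit vector, and \<open>ladder n k 1 c\<close> puts
    \<open>c\<close> there.\<close>
  then have "(ladder n k 1 e \<circ> ladder n k 0 (- e)) (unit_fun (2 * k + 1)) 1
      = (ladder n k 1 e' \<circ> ladder n k 0 (- e')) (unit_fun (2 * k + 1)) 1"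
    using assms by metis
  moreover have "(ladder n k 1 c \<circ> ladder n k 0 (- c)) (unit_fun (2 * k + 1)) 1 = c" for c
    using k n by (simp add: ladder_def addU_apply unit_fun_def)
  ultimately show ?thesis by simp
qed

section \<open>Generation by the three elements\<close>

abbreviation "generators \<equiv> {mat_of n (permP n \<sigma>), mat_of n (permP n \<tau>), mat_of n (rung n k q 1)}"

lemma generators_carrier: "generators \<subseteq> carrier (Sp_int n)"
  using sp_map_perms sp_map_rung by (auto intro: mat_of_Sp)

lemma generate_generators: "generate (Sp_int n) generators = carrier (Sp_int n)"
proof -
  interpret grp: group "Sp_int n" by (rule group_Sp_int)
  let ?G = "generate (Sp_int n) generators"
  interpret G: sp_subgroup n ?G
    using grp.generate_is_subgroup[OF generators_carrier] by (rule sp_subgroup.intro)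
  have gs: "G.good (permP n \<sigma>)" "G.good (permP n \<tau>)" "G.good (rung n k q 1)"
    using sp_map_perms sp_map_rung by (auto simp: G.good_def intro: generate.incl)
  interpret G: sp_perm_subgroup n ?G \<sigma> \<tau>
    using bij gs link by unfold_locales
  let ?P = "permP n \<sigma>" and ?u = "ladder n k"
  obtain P' where P': "sp_map n P'" "?P \<circ> P' = id" "P' \<circ> ?P = id"
    using permP_inverse[OF bij(1)] by blast
  have gP': "G.good P'" using G.good_inverse[OF gs(1) P'(1,2)] .
  have uu: "?u i e \<circ> ?u i (- e) = id" "?u i (- e) \<circ> ?u i e = id" "sp_map n (?u i e)" if "i \<le> 2" for i e
    using ladder_props[OF k n that] by auto
  have inv: "?u i 1 (?u i (-1) x) = x" "?u i (-1) (?u i 1 x) = x" if "i \<le> 2" for i x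
    using uu(1,2)[OF that, of 1] by (simp_all add: pointfree_idE)
  have Pinv: "?P (P' x) = x" "P' (?P x) = x" for x
    using P' by (simp_all add: pointfree_idE)
  have Pu: "?P (?u (Suc i) e x) = ?u i e (?P x)" if "i \<le> 1" for i e x
    using permP_ladder[OF k n q_ge fits(1) that, of e] by (rule comp_eq_dest)
  have comm: "?u (Suc i) c (?u i d x) = ?u i d (?u (Suc i) c x)" if "i \<le> 1" for i c d x
    using ladder_commute[OF k n that, of c d] by (rule comp_eq_dest)
  \<comment> \<open>Write u_i for \<open>?u i 1\<close>. The quotients of \<rho> by \<sigma> are u_2
    u_1^-1 and u_1 u_0^-1. Their products in the two orders are u_2 u_0^-1 and, as neighbours
    commute, u_0^-1 u_2, which differ by a commutator.\<close>
  have "P' \<circ> rung n k q 1 = ?u 2 1 \<circ> ?u 1 (-1)"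
  proof
    fix x
    have "?u 1 1 (?P (?u 1 (-1) x)) = ?P (?u 2 1 (?u 1 (-1) x))"
      using Pu[of 1 1] by (simp add: numeral_2_eq_2)
    then show "(P' \<circ> rung n k q 1) x = (?u 2 1 \<circ> ?u 1 (-1)) x"
      by (simp add: rung_def Pinv)
  qed
  then have g21: "G.good (?u 2 1 \<circ> ?u 1 (-1))" using G.good_comp[OF gP' gs(3)] by simp
  have "rung n k q 1 \<circ> P' = ?u 1 1 \<circ> ?u 0 (-1)"
    by (rule ext) (simp add: rung_eq Pinv)
  then have g10: "G.good (?u 1 1 \<circ> ?u 0 (-1))" using G.good_comp[OF gs(3) gP'] by simp
  have "?u 2 1 \<circ> ?u 1 (-1) \<circ> (?u 1 1 \<circ> ?u 0 (-1)) = ?u 2 1 \<circ> ?u 0 (-1)"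
    by (rule ext) (simp add: inv)
  then have g20: "G.good (?u 2 1 \<circ> ?u 0 (-1))" using G.good_comp[OF g21 g10] by simp
  have "?u 1 1 \<circ> ?u 0 (-1) \<circ> (?u 2 1 \<circ> ?u 1 (-1)) = ?u 0 (-1) \<circ> ?u 2 1"
  proof
    fix x
    have "?u 2 1 (?u 1 (-1) x) = ?u 1 (-1) (?u 2 1 x)"
      using comm[of 1 1 "-1" x] by (simp add: numeral_2_eq_2)
    moreover have "?u 1 1 (?u 0 (-1) y) = ?u 0 (-1) (?u 1 1 y)" for y
      using comm[of 0 1 "-1" y] by simp
    ultimately show "(?u 1 1 \<circ> ?u 0 (-1) \<circ> (?u 2 1 \<circ> ?u 1 (-1))) x = (?u 0 (-1) \<circ> ?u 2 1) x"
      using inv(1)[of 1 "?u 2 1 x"] by (simp only: o_apply)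
  qed
  then have g02: "G.good (?u 0 (-1) \<circ> ?u 2 1)" using G.good_comp[OF g10 g21] by simp
  have "?u 0 (-1) \<circ> ?u 2 1 \<circ> (?u 2 (-1) \<circ> ?u 0 1) = id"
    by (rule ext) (simp add: inv)
  then have g02': "G.good (?u 2 (-1) \<circ> ?u 0 1)"
    using G.good_inverse[OF g02 sp_map_comp] uu(3) by simp
  \<comment> \<open>The index \<open>2 * k + 2\<close> is shared by u_2 and u_0, in the role of
    \<open>b\<close> in \<open>addU_swap\<close>.\<close>
  have swap: "?u 2 1 \<circ> ?u 0 (-1) = addX n 2 (k + 2) (-1) \<circ> (?u 0 (-1) \<circ> ?u 2 1)"
    unfolding ladder_values using k n by (intro addU_swap) auto
  have "?u 2 1 \<circ> ?u 0 (-1) \<circ> (?u 2 (-1) \<circ> ?u 0 1) = addX n 2 (k + 2) (-1)"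
    unfolding swap by (rule ext) (simp add: inv)
  then have "G.good (addX n 2 (k + 2) (-1))" using G.good_comp[OF g20 g02'] by simp
  then have "G.good (addX n 2 (k + 2) 1)" using G.good_addX_multiple[of 2 "k + 2" "-1" 1] k n by simp
  then have "G.linked 2 (k + 2)" using k n by (simp add: G.linked_def)
  then have l1: "G.linked 1 (k + 1)"
    using G.linked_perm(1)[of 1 "k + 1", unfolded cycle_values(2,4)] k n by simp
  then have "G.linked 0 k" using G.linked_perm(1)[of 0 k, unfolded cycle_values(1,3)] k n by simp
  \<comment> \<open>\<tau> fixes 0 and sends \<open>k\<close> to 1 or to \<open>k + 1\<close>, which
    is linked to 1. Either way 0 is linked to \<open>\<sigma> 0\<close>.\<close>
  then have l0: "G.linked 0 (\<tau> k)" using G.linked_perm(2)[of 0 k] k n cycle_values(5) by simp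
  have "G.linked 0 (\<sigma> 0)"
  proof (cases "s = 1")
    case True
    then show ?thesis using l0 cycle_values(1,6) by simp
  next
    case False
    then show ?thesis using l0 cycle_values(1,7) G.linked_trans[OF _ G.linked_sym[OF l1]] by simp
  qed
  moreover have "G.linked 0 (\<tau> 0)" using k n by (simp add: cycle_values(5) G.linked_def)
  ultimately have X: "G.good (addX n i j c)" if "i < n" "j < n" "i \<noteq> j" for i j c
    using G.good_addX_all that k n by simp
  \<comment> \<open>All \<open>addX\<close> maps are now available, so those in u_2 u_1^-1 can be
    stripped off.\<close>
  have "addX n 1 (2 * k + 1) 1 \<circ> addX n (2 * k + 3) (k + 3) 1 \<circ> addX n 2 (2 * k + 2) (-1)
      \<circ> addX n (2 * k + 4) (k + 4) (-1) \<circ> (?u 2 1 \<circ> ?u 1 (-1)) = addQ n 2 1 (k + 4) (k + 3) 1"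
    unfolding ladder_values using k n by (intro addQ_of_addU) auto
  moreover have "G.good (addX n 1 (2 * k + 1) 1 \<circ> addX n (2 * k + 3) (k + 3) 1 \<circ> addX n 2 (2 * k + 2) (-1)
      \<circ> addX n (2 * k + 4) (k + 4) (-1) \<circ> (?u 2 1 \<circ> ?u 1 (-1)))"
    using k n by (intro G.good_comp[OF _ g21] G.good_comp X) auto
  ultimately have "G.good (addQ n 2 1 (k + 4) (k + 3) 1)" by simp
  \<comment> \<open>The auxiliary indices \<open>2 * k\<close> and 0 avoid 1, 2,
    \<open>k + 3\<close> and \<open>k + 4\<close>, as \<open>5 \<le> k\<close>.\<close>
  then have YZ: "G.good (addY n (2 * k) 1)" "G.good (addZ n (2 * k) 1)"
    using G.good_addYZ_of_addQ[OF X, of 2 1 "k + 4" "k + 3" "2 * k" 0] k n by auto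
  have k2: "2 * k < n" using k n by simp
  interpret elementary_sp_subgroup n ?G
    using X G.good_addYZ_all[OF k2] YZ by unfold_locales auto
  show ?thesis by (rule eq_carrier)
qed

lemma exists_generators:
  assumes c: "3 \<le> c" "c \<le> 4"
  shows "\<exists>S. S \<subseteq> carrier (Sp_int n) \<and> card S = c \<and> (\<forall>A\<in>S. group.ord (Sp_int n) A = k) \<and>
    generate (Sp_int n) S = carrier (Sp_int n)"
proof -
  interpret grp: group "Sp_int n" by (rule group_Sp_int)
  \<comment> \<open>Four values of \<open>e\<close> give four distinct matrices, so \<open>S\<close>
    can be given exactly \<open>c\<close> elements whatever the size of
    \<open>generators\<close>.\<close>
  let ?T = "(\<lambda>e. mat_of n (rung n k q e)) ` {0..3}"
  have "inj_on (\<lambda>e. mat_of n (rung n k q e)) {0..3}"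
    by (rule inj_onI) (use mat_of_inj[OF sp_map_rung sp_map_rung] rung_inj in blast)
  then have "card ?T = 4" by (simp add: card_image)
  then have "4 \<le> card (generators \<union> ?T)" by (metis card_mono finite_Un finite_imageI finite_atLeastAtMost_int finite.emptyI finite.insertI sup_ge2)
  moreover have "card generators \<le> 3" by (simp add: card_insert_if)
  ultimately obtain S where S: "generators \<subseteq> S" "S \<subseteq> generators \<union> ?T" "card S = c"
    using exists_subset_between[of generators c "generators \<union> ?T"] c by auto
  have T: "A \<in> carrier (Sp_int n) \<and> group.ord (Sp_int n) A = k" if "A \<in> generators \<union> ?T" for A
    using that generators_carrier ord_perms ord_rung sp_map_rung mat_of_Sp by auto
  have Sc: "S \<subseteq> carrier (Sp_int n)" using S(2) T by blast
  have "generate (Sp_int n) S = carrier (Sp_int n)"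
    using grp.mono_generate[OF S(1)] grp.generate_incl[OF Sc] generate_generators by blast
  moreover have "\<forall>A\<in>S. group.ord (Sp_int n) A = k" using T S(2) by blast
  ultimately show ?thesis using Sc S(3) by (intro exI[of _ S] conjI)
qed

end

theorem theorem1p4:
  fixes k n :: nat
  shows "(k \<ge> 5 \<and> n \<ge> 2 * (k - 1) * (k - 3) \<longrightarrow>
           (\<exists>S. S \<subseteq> carrier (Sp_int n) \<and> card S = 4 \<and>
              (\<forall>A\<in>S. group.ord (Sp_int n) A = k) \<and> generate (Sp_int n) S = carrier (Sp_int n))) \<and>
         (k \<ge> 6 \<and> n \<ge> 2 * ((k - 1)\<^sup>2 + 1) \<longrightarrow>
           (\<exists>S. S \<subseteq> carrier (Sp_int n) \<and> card S = 3 \<and>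
              (\<forall>A\<in>S. group.ord (Sp_int n) A = k) \<and> generate (Sp_int n) S = carrier (Sp_int n)))"
proof -
  have main: "\<exists>S. S \<subseteq> carrier (Sp_int n) \<and> card S = c \<and>
      (\<forall>A\<in>S. group.ord (Sp_int n) A = k) \<and> generate (Sp_int n) S = carrier (Sp_int n)"
    if "5 \<le> k" "3 * k \<le> n" "3 \<le> c" "c \<le> 4" for c
  proof -
    interpret block_setup n k "n div k" "if n mod k = 0 then 1 else n mod k"
        "if n mod k = 0 then n div k - 1 else n div k"
      by unfold_locales (use that in auto)
    show ?thesis using exists_generators[OF that(3,4)] .
  qed
  have "3 * k \<le> 2 * (k - 1) * (k - 3)" if k5: "5 \<le> k"
  proof -
    \<comment> \<open>The substitution removes the truncated subtractions and leaves polynomials in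
      \<open>m\<close> to compare coefficientwise.\<close>
    obtain m where m: "k = 5 + m" using le_Suc_ex[OF k5] by blast
    show ?thesis by (simp add: m algebra_simps)
  qed
  moreover have "3 * k \<le> 2 * ((k - 1)\<^sup>2 + 1)" if k6: "6 \<le> k"
  proof -
    obtain m where m: "k = 6 + m" using le_Suc_ex[OF k6] by blast
    show ?thesis by (simp add: m algebra_simps power2_eq_square)
  qed
  ultimately show ?thesis using main[of 4] main[of 3] by auto
qed

end
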